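(* Let $(\mathfrak{g},[\,,\,]_{\cdot},[\,,\,]_{\circ},\triangleright)$ be an integrable finite-dimensional real post-Lie algebra such that both Lie algebras $(\mathfrak{g},[\,,\,]_{\cdot})$ and $(\mathfrak{g},[\,,\,]_{\circ})$ are nilpotent. Assume that $\dim\mathfrak{g}>1$. Then there exists a nonzero proper ideal $\mathfrak{i}\subsetneq\mathfrak{g}$ of the post-Lie algebra such that the quotient post-Lie algebra $\mathfrak{g}/\mathfrak{i}$ is trivial.
   Context: A post-Lie algebra is a quadruple $(\mathfrak{g},[\,,\,]_{\cdot},[\,,\,]_{\circ},\triangleright)$ where $(\mathfrak{g},[\,,\,]_{\cdot})$ and $(\mathfrak{g},[\,,\,]_{\circ})$ are Lie algebras on the same finite-dimensional real vector space and $\triangleright:\mathfrak{g}\times\mathfrak{g}\to\mathfrak{g}$ is bilinear with, for all $x,y,z\in\mathfrak{g}$: $[x,y]_{\circ}-[x,y]_{\cdot}=x\triangleright y-y\triangleright x$; $x\triangleright[y,z]_{\cdot}=[x\triangleright y,z]_{\cdot}+[y,x\triangleright z]_{\cdot}$; $[x,y]_{\circ}\triangleright z=x\triangleright(y\triangleright z)-y\triangleright(x\triangleright z)$. It is trivial if $[\,,\,]_{\cdot}=[\,,\,]_{\circ}=\triangleright=0$. An ideal of the post-Lie algebra is a vector subspace $\mathfrak{i}\subseteq\mathfrak{g}$ with $[\mathfrak{g},\mathfrak{i}]_{\cdot}\subseteq\mathfrak{i}$, $\mathfrak{g}\triangleright\mathfrak{i}\subseteq\mathfrak{i}$ and $\mathfrak{i}\triangleright\mathfrak{g}\subseteq\mathfrak{i}$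 (then also $[\mathfrak{g},\mathfrak{i}]_{\circ}\subseteq\mathfrak{i}$, and $\mathfrak{g}/\mathfrak{i}$ inherits a quotient post-Lie structure). A Lie skew brace $(G,\cdot,\circ)$ is a (finite-dimensional, real) smooth manifold $G$ with two Lie group structures $(G,\cdot)$ and $(G,\circ)$ such that $g\circ(h\cdot k)=(g\circ h)\cdot g^{-1}\cdot(g\circ k)$ for all $g,h,k\in G$, where $g^{-1}$ is the inverse with respect to $\cdot$. Set $\lambda_g(h):=g^{-1}\cdot(g\circ h)$; this gives a smooth homomorphism $\lambda:(G,\circ)\to\operatorname{Aut}(G,\cdot)$. The post-Lie algebra associated with a connected Lie skew brace is $T_eG$ with the brackets of $\operatorname{Lie}(G,\cdot)$ and $\operatorname{Lie}(G,\circ)$ and $x\triangleright y:=\lambda_{*e}(x)(y)$, i.e. $x\triangleright y=\frac{d}{dt}\big|_{t=0}(\lambda_{\gamma(t)})_{*e}(y)$ for any smooth curve $\gamma$ with $\gamma(0)=e$, $\gamma'(0)=x$. A post-Lie algebra is integrable if it is (isomorphic to) the post-Lie algebra associated with a connected, simply connected Lie skew brace. *)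

theory Defs
  imports "HOL-Analysis.Analysis" "HOL-Algebra.Group"
begin

section \<open>Post-Lie algebras\<close>

locale lie_algebra =
  fixes br :: "'g::real_vector \<Rightarrow> 'g \<Rightarrow> 'g"
  assumes bilinear: "bilinear br"
    and alternating: "br x x = 0"
    and jacobi: "br x (br y z) + br y (br z x) + br z (br x y) = 0"

locale post_lie_algebra =
  dot: lie_algebra dot + circ: lie_algebra circ
  for dot circ :: "'g::real_vector \<Rightarrow> 'g \<Rightarrow> 'g" +
  fixes tri :: "'g \<Rightarrow> 'g \<Rightarrow> 'g"
  assumes finite_dimensional: "\<exists>B :: 'g set. finite B \<and> span B = UNIV"
    and tri_bilinear: "bilinear tri"
    and circ_minus_dot: "circ x y - dot x y = tri x y - tri y x"
    and tri_derivation: "tri x (dot y z) = dot (tri x y) z + dot y (tri x z)"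
    and tri_circ: "tri (circ x y) z = tri x (tri y z) - tri y (tri x z)"

primrec lower_central_series :: "('g::real_vector \<Rightarrow> 'g \<Rightarrow> 'g) \<Rightarrow> nat \<Rightarrow> 'g set" where
  "lower_central_series br 0 = UNIV"
| "lower_central_series br (Suc n) = span {br x y | x y. y \<in> lower_central_series br n}"

definition nilpotent_lie :: "('g::real_vector \<Rightarrow> 'g \<Rightarrow> 'g) \<Rightarrow> bool" where
  "nilpotent_lie br \<longleftrightarrow> (\<exists>n. lower_central_series br n = {0})"

definition post_lie_ideal ::
  "('g::real_vector \<Rightarrow> 'g \<Rightarrow> 'g) \<Rightarrow> ('g \<Rightarrow> 'g \<Rightarrow> 'g) \<Rightarrow> 'g set \<Rightarrow> bool" where
  "post_lie_ideal dot tri I \<longleftrightarrow> subspace I \<and>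
     (\<forall>x. \<forall>y\<in>I. dot x y \<in> I \<and> tri x y \<in> I \<and> tri y x \<in> I)"

text \<open>The vector space \<open>g/I\<close> is the set of cosets \<open>x + I\<close>, with zero element \<open>I\<close>. Its
  operations are induced from representatives; they are well defined if \<open>I\<close> is an ideal, by
  the lemma \<open>ideal_quotient_op_coset\<close> below.\<close>

definition coset :: "'g::real_vector set \<Rightarrow> 'g \<Rightarrow> 'g set" where
  "coset I x = (\<lambda>a. x + a) ` I"

definition quotient_space :: "'g::real_vector set \<Rightarrow> 'g set set" where
  "quotient_space I = range (coset I)"

definition quotient_op ::
  "'g::real_vector set \<Rightarrow> ('g \<Rightarrow> 'g \<Rightarrow> 'g) \<Rightarrow> 'g set \<Rightarrow> 'g set \<Rightarrow> 'g set" where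
  "quotient_op I f P Q = (\<Union>x\<in>P. \<Union>y\<in>Q. coset I (f x y))"

definition trivial_post_lie ::
  "'q set \<Rightarrow> 'q \<Rightarrow> ('q \<Rightarrow> 'q \<Rightarrow> 'q) \<Rightarrow> ('q \<Rightarrow> 'q \<Rightarrow> 'q) \<Rightarrow> ('q \<Rightarrow> 'q \<Rightarrow> 'q) \<Rightarrow> bool" where
  "trivial_post_lie C z dot circ tri \<longleftrightarrow>
     (\<forall>x\<in>C. \<forall>y\<in>C. dot x y = z \<and> circ x y = z \<and> tri x y = z)"

definition trivial_quotient ::
  "('g::real_vector \<Rightarrow> 'g \<Rightarrow> 'g) \<Rightarrow> ('g \<Rightarrow> 'g \<Rightarrow> 'g) \<Rightarrow> ('g \<Rightarrow> 'g \<Rightarrow> 'g) \<Rightarrow> 'g set \<Rightarrow> bool" where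
  "trivial_quotient dot circ tri I \<longleftrightarrow>
     trivial_post_lie (quotient_space I) I
       (quotient_op I dot) (quotient_op I circ) (quotient_op I tri)"

lemma coset_eq_iff:
  assumes "subspace I"
  shows "coset I x = coset I y \<longleftrightarrow> x - y \<in> I"
proof
  assume eq: "coset I x = coset I y"
  have "x + 0 \<in> coset I x"
    unfolding coset_def using subspace_0[OF assms] by (rule imageI)
  then obtain a where "a \<in> I" "x = y + a"
    unfolding eq by (auto simp: coset_def)
  then show "x - y \<in> I" by simp
next
  have sub: "coset I x \<subseteq> coset I y" if "x - y \<in> I" for x y
  proof
    fix w assume "w \<in> coset I x"
    then obtain a where "a \<in> I" "w = x + a" by (auto simp: coset_def)
    then have "w = y + ((x - y) + a)" "(x - y) + a \<in> I"
      using that assms by (auto intro: subspace_add)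
    then show "w \<in> coset I y" unfolding coset_def by blast
  qed
  assume "x - y \<in> I"
  moreover from this have "y - x \<in> I"
    using subspace_neg[OF assms] by fastforce
  ultimately show "coset I x = coset I y" using sub by blast
qed

lemma quotient_op_coset:
  assumes "subspace I" "bilinear f"
    and left: "\<And>x y. y \<in> I \<Longrightarrow> f x y \<in> I" and right: "\<And>x y. y \<in> I \<Longrightarrow> f y x \<in> I"
  shows "quotient_op I f (coset I x) (coset I y) = coset I (f x y)"
proof -
  have "coset I (f (x + a) (y + b)) = coset I (f x y)" if "a \<in> I" "b \<in> I" for a b
  proof -
    have "f (x + a) (y + b) - f x y = f x b + f a (y + b)"
      using assms(2) by (simp add: bilinear_ladd bilinear_radd)
    then show ?thesis
      using that assms by (simp add: coset_eq_iff subspace_add)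
  qed
  moreover have "0 \<in> I" using assms(1) by (rule subspace_0)
  ultimately show ?thesis by (auto simp: quotient_op_def coset_def)
qed

lemma (in post_lie_algebra) ideal_quotient_op_coset:
  assumes "post_lie_ideal dot tri I"
  shows "quotient_op I dot (coset I x) (coset I y) = coset I (dot x y)"
    and "quotient_op I circ (coset I x) (coset I y) = coset I (circ x y)"
    and "quotient_op I tri (coset I x) (coset I y) = coset I (tri x y)"
proof -
  have I: "subspace I"
    and l: "\<And>x y. y \<in> I \<Longrightarrow> dot x y \<in> I" "\<And>x y. y \<in> I \<Longrightarrow> tri x y \<in> I"
    and tr: "\<And>x y. y \<in> I \<Longrightarrow> tri y x \<in> I"
    using assms by (auto simp: post_lie_ideal_def)
  have "dot x y + dot y x = 0" for x y
    using dot.alternating[of "x + y"] dot.alternating[of x] dot.alternating[of y]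
    by (simp add: bilinear_ladd[OF dot.bilinear] bilinear_radd[OF dot.bilinear] add.commute)
  then have "dot y x = - dot x y" for x y
    using add_eq_0_iff by blast
  then have dr: "dot y x \<in> I" if "y \<in> I" for x y
    using l(1)[OF that, of x] subspace_neg[OF I] by metis
  have c: "circ x y = dot x y + tri x y - tri y x" for x y
    using circ_minus_dot[of x y] by (simp add: algebra_simps)
  have cl: "circ x y \<in> I" "circ y x \<in> I" if "y \<in> I" for x y
    using that l tr dr I by (auto simp: c intro!: subspace_add subspace_diff)
  show "quotient_op I dot (coset I x) (coset I y) = coset I (dot x y)"
    by (rule quotient_op_coset[OF I dot.bilinear]) (use l dr in auto)
  show "quotient_op I circ (coset I x) (coset I y) = coset I (circ x y)"
    by (rule quotient_op_coset[OF I circ.bilinear]) (use cl in auto)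
  show "quotient_op I tri (coset I x) (coset I y) = coset I (tri x y)"
    by (rule quotient_op_coset[OF I tri_bilinear]) (use l tr in auto)
qed

section \<open>Smooth manifolds\<close>

text \<open>Only meaningful for open \<open>S\<close>.\<close>

primrec times_differentiable_on ::
  "nat \<Rightarrow> 'e::real_normed_vector set \<Rightarrow> ('e \<Rightarrow> 'f::real_normed_vector) \<Rightarrow> bool" where
  "times_differentiable_on 0 S f \<longleftrightarrow> continuous_on S f"
| "times_differentiable_on (Suc k) S f \<longleftrightarrow>
     (\<forall>x\<in>S. f differentiable (at x)) \<and>
     (\<forall>v. times_differentiable_on k S (\<lambda>x. frechet_derivative f (at x) v))"

definition smooth_on ::
  "'e::real_normed_vector set \<Rightarrow> ('e \<Rightarrow> 'f::real_normed_vector) \<Rightarrow> bool" where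
  "smooth_on S f \<longleftrightarrow> (\<forall>k. times_differentiable_on k S f)"

text \<open>A chart is a pair \<open>(U, \<phi>)\<close>; the values of \<open>\<phi>\<close> outside \<open>U\<close> are irrelevant. A manifold
  is a whole type, Hausdorff and second countable by its class, with a smooth atlas (not
  necessarily a maximal one).\<close>

type_synonym ('a, 'e) chart = "'a set \<times> ('a \<Rightarrow> 'e)"

definition smooth_atlas ::
  "('a::{t2_space,second_countable_topology}, 'e::euclidean_space) chart set \<Rightarrow> bool" where
  "smooth_atlas A \<longleftrightarrow>
     (\<Union>(U, \<phi>)\<in>A. U) = UNIV \<and>
     (\<forall>(U, \<phi>)\<in>A. open U \<and> open (\<phi> ` U) \<and> homeomorphism U (\<phi> ` U) \<phi> (inv_into U \<phi>)) \<and>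
     (\<forall>(U, \<phi>)\<in>A. \<forall>(V, \<psi>)\<in>A. smooth_on (\<phi> ` (U \<inter> V)) (\<psi> \<circ> inv_into U \<phi>))"

definition standard_atlas :: "('e::euclidean_space, 'e) chart set" where
  "standard_atlas = {(UNIV, id)}"

definition prod_atlas ::
  "('a, 'e) chart set \<Rightarrow> ('b, 'f) chart set \<Rightarrow> ('a \<times> 'b, 'e \<times> 'f) chart set" where
  "prod_atlas A B = {(U \<times> V, map_prod \<phi> \<psi>) | U \<phi> V \<psi>. (U, \<phi>) \<in> A \<and> (V, \<psi>) \<in> B}"

text \<open>Smoothness on the open set \<open>N\<close> of a map between manifolds with the atlases \<open>A\<close> and \<open>B\<close>.\<close>

definition smooth_map_on ::
  "('a::topological_space, 'e::euclidean_space) chart set \<Rightarrow>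
   ('b::topological_space, 'f::euclidean_space) chart set \<Rightarrow> 'a set \<Rightarrow> ('a \<Rightarrow> 'b) \<Rightarrow> bool" where
  "smooth_map_on A B N F \<longleftrightarrow> continuous_on N F \<and>
     (\<forall>(U, \<phi>)\<in>A. \<forall>(V, \<psi>)\<in>B. smooth_on (\<phi> ` (N \<inter> U \<inter> F -` V)) (\<psi> \<circ> F \<circ> inv_into U \<phi>))"

definition smooth_near ::
  "('a::topological_space, 'e::euclidean_space) chart set \<Rightarrow> 'a \<Rightarrow> ('a \<Rightarrow> real) \<Rightarrow> bool" where
  "smooth_near A p f \<longleftrightarrow> (\<exists>N. open N \<and> p \<in> N \<and> smooth_map_on A standard_atlas N f)"

definition smooth_curve_at ::
  "('a::topological_space, 'e::euclidean_space) chart set \<Rightarrow> 'a \<Rightarrow> (real \<Rightarrow> 'a) \<Rightarrow> bool" where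
  "smooth_curve_at A p \<gamma> \<longleftrightarrow>
     \<gamma> 0 = p \<and> (\<exists>\<epsilon>>0. smooth_map_on standard_atlas A {-\<epsilon><..<\<epsilon>} \<gamma>)"

text \<open>A tangent vector at \<open>p\<close> is the velocity \<open>\<gamma>'(0)\<close> of a smooth curve with \<open>\<gamma>(0) = p\<close>,
  regarded as the derivation \<open>f \<mapsto> (f \<circ> \<gamma>)'(0)\<close> on the real functions that are smooth near
  \<open>p\<close>. On all other functions it is set to \<open>0\<close>, so that equality of tangent vectors is equality
  in HOL. The vector space operations of the tangent space are the pointwise ones.\<close>

type_synonym 'a tangent = "('a \<Rightarrow> real) \<Rightarrow> real"

definition velocity ::
  "('a::topological_space, 'e::euclidean_space) chart set \<Rightarrow> (real \<Rightarrow> 'a) \<Rightarrow> 'a tangent" where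
  "velocity A \<gamma> = (\<lambda>f. if smooth_near A (\<gamma> 0) f then deriv (\<lambda>t. f (\<gamma> t)) 0 else 0)"

definition tangent_space ::
  "('a::topological_space, 'e::euclidean_space) chart set \<Rightarrow> 'a \<Rightarrow> 'a tangent set" where
  "tangent_space A p = {velocity A \<gamma> | \<gamma>. smooth_curve_at A p \<gamma>}"

text \<open>The differential at \<open>p\<close> of a map \<open>F\<close> from a manifold into the one with atlas \<open>B\<close>.\<close>

definition differential ::
  "('b::topological_space, 'f::euclidean_space) chart set \<Rightarrow> 'a \<Rightarrow> ('a \<Rightarrow> 'b) \<Rightarrow>
   'a tangent \<Rightarrow> 'b tangent" where
  "differential B p F X = (\<lambda>f. if smooth_near B (F p) f then X (\<lambda>q. f (F q)) else 0)"

text \<open>The value at \<open>p\<close> of the commutator \<open>V W - W V\<close> of two vector fields.\<close>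

definition field_bracket ::
  "('a::topological_space, 'e::euclidean_space) chart set \<Rightarrow>
   ('a \<Rightarrow> 'a tangent) \<Rightarrow> ('a \<Rightarrow> 'a tangent) \<Rightarrow> 'a \<Rightarrow> 'a tangent" where
  "field_bracket A V W p =
     (\<lambda>f. if smooth_near A p f then V p (\<lambda>q. W q f) - W p (\<lambda>q. V q f) else 0)"

section \<open>Lie groups and Lie skew braces\<close>

definition lie_group ::
  "('a::{t2_space,second_countable_topology}, 'e::euclidean_space) chart set \<Rightarrow>
   'a monoid \<Rightarrow> bool" where
  "lie_group A G \<longleftrightarrow> smooth_atlas A \<and> group G \<and> carrier G = UNIV \<and>
     smooth_map_on (prod_atlas A A) A UNIV (\<lambda>(g, h). g \<otimes>\<^bsub>G\<^esub> h) \<and>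
     smooth_map_on A A UNIV (\<lambda>g. inv\<^bsub>G\<^esub> g)"

definition left_invariant_field ::
  "('a::topological_space, 'e::euclidean_space) chart set \<Rightarrow> 'a monoid \<Rightarrow>
   'a tangent \<Rightarrow> 'a \<Rightarrow> 'a tangent" where
  "left_invariant_field A G X g = differential A \<one>\<^bsub>G\<^esub> (\<lambda>h. g \<otimes>\<^bsub>G\<^esub> h) X"

definition lie_bracket ::
  "('a::topological_space, 'e::euclidean_space) chart set \<Rightarrow> 'a monoid \<Rightarrow>
   'a tangent \<Rightarrow> 'a tangent \<Rightarrow> 'a tangent" where
  "lie_bracket A G X Y =
     field_bracket A (left_invariant_field A G X) (left_invariant_field A G Y) \<one>\<^bsub>G\<^esub>"

definition lie_skew_brace ::
  "('a::{t2_space,second_countable_topology}, 'e::euclidean_space) chart set \<Rightarrow>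
   'a monoid \<Rightarrow> 'a monoid \<Rightarrow> bool" where
  "lie_skew_brace A G H \<longleftrightarrow> lie_group A G \<and> lie_group A H \<and>
     (\<forall>g h k. g \<otimes>\<^bsub>H\<^esub> (h \<otimes>\<^bsub>G\<^esub> k) = (g \<otimes>\<^bsub>H\<^esub> h) \<otimes>\<^bsub>G\<^esub> inv\<^bsub>G\<^esub> g \<otimes>\<^bsub>G\<^esub> (g \<otimes>\<^bsub>H\<^esub> k))"

lemma lie_skew_brace_one:
  assumes "lie_skew_brace A G H"
  shows "\<one>\<^bsub>H\<^esub> = \<one>\<^bsub>G\<^esub>"
proof -
  interpret G: group G using assms by (simp add: lie_skew_brace_def lie_group_def)
  interpret H: group H using assms by (simp add: lie_skew_brace_def lie_group_def)
  have [simp]: "x \<in> carrier G" "x \<in> carrier H" for x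
    using assms by (simp_all add: lie_skew_brace_def lie_group_def)
  have "\<one>\<^bsub>H\<^esub> \<otimes>\<^bsub>H\<^esub> (\<one>\<^bsub>G\<^esub> \<otimes>\<^bsub>G\<^esub> \<one>\<^bsub>G\<^esub>) =
        (\<one>\<^bsub>H\<^esub> \<otimes>\<^bsub>H\<^esub> \<one>\<^bsub>G\<^esub>) \<otimes>\<^bsub>G\<^esub> inv\<^bsub>G\<^esub> \<one>\<^bsub>H\<^esub> \<otimes>\<^bsub>G\<^esub> (\<one>\<^bsub>H\<^esub> \<otimes>\<^bsub>H\<^esub> \<one>\<^bsub>G\<^esub>)"
    using assms unfolding lie_skew_brace_def by blast
  then have "inv\<^bsub>G\<^esub> \<one>\<^bsub>H\<^esub> = \<one>\<^bsub>G\<^esub>" by simp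
  then show ?thesis by (metis G.inv_inv G.inv_one \<open>\<And>x. x \<in> carrier G\<close>)
qed

definition brace_lambda :: "'a monoid \<Rightarrow> 'a monoid \<Rightarrow> 'a \<Rightarrow> 'a \<Rightarrow> 'a" where
  "brace_lambda G H g h = inv\<^bsub>G\<^esub> g \<otimes>\<^bsub>G\<^esub> (g \<otimes>\<^bsub>H\<^esub> h)"

text \<open>The derivative in direction \<open>X\<close> of the map from the group to its tangent space at the
  identity that sends \<open>g\<close> to the image of \<open>Y\<close> under the differential of \<open>\<lambda>\<^sub>g\<close>. For
  \<open>X = \<gamma>'(0)\<close>, applying \<open>X\<close> to a function of \<open>g\<close> means substituting \<open>g = \<gamma>(t)\<close> and
  differentiating at \<open>t = 0\<close>.\<close>

definition brace_triangle ::
  "('a::topological_space, 'e::euclidean_space) chart set \<Rightarrow> 'a monoid \<Rightarrow> 'a monoid \<Rightarrow>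
   'a tangent \<Rightarrow> 'a tangent \<Rightarrow> 'a tangent" where
  "brace_triangle A G H X Y =
     (\<lambda>f. if smooth_near A \<one>\<^bsub>G\<^esub> f
           then X (\<lambda>g. differential A \<one>\<^bsub>G\<^esub> (brace_lambda G H g) Y f) else 0)"

text \<open>HOL cannot quantify over types inside a formula, so the underlying type \<open>'a\<close> of the Lie
  skew brace and the model space \<open>'e\<close> of its charts are parameters; as an assumption of a theorem
  with \<open>'a\<close> and \<open>'e\<close> not fixed elsewhere, this is existential quantification over both.
  The map \<open>\<Phi>\<close> is an isomorphism onto the post-Lie algebra associated with the Lie skew brace.\<close>

definition integrable_post_lie ::
  "('a::{t2_space,second_countable_topology}) itself \<Rightarrow> ('e::euclidean_space) itself \<Rightarrow>
   ('g::real_vector \<Rightarrow> 'g \<Rightarrow> 'g) \<Rightarrow> ('g \<Rightarrow> 'g \<Rightarrow> 'g) \<Rightarrow> ('g \<Rightarrow> 'g \<Rightarrow> 'g) \<Rightarrow> bool" where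
  "integrable_post_lie TA TE dot circ tri \<longleftrightarrow>
     (\<exists>(A :: ('a, 'e) chart set) G H (\<Phi> :: 'g \<Rightarrow> 'a tangent).
        lie_skew_brace A G H \<and>
        connected (UNIV :: 'a set) \<and> simply_connected (UNIV :: 'a set) \<and>
        bij_betw \<Phi> UNIV (tangent_space A \<one>\<^bsub>G\<^esub>) \<and>
        (\<forall>x y f. \<Phi> (x + y) f = \<Phi> x f + \<Phi> y f) \<and>
        (\<forall>c x f. \<Phi> (c *\<^sub>R x) f = c * \<Phi> x f) \<and>
        (\<forall>x y. \<Phi> (dot x y) = lie_bracket A G (\<Phi> x) (\<Phi> y)) \<and>
        (\<forall>x y. \<Phi> (circ x y) = lie_bracket A H (\<Phi> x) (\<Phi> y)) \<and>
        (\<forall>x y. \<Phi> (tri x y) = brace_triangle A G H (\<Phi> x) (\<Phi> y)))"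

end

theory Submission
  imports Defs "HOL-Library.Function_Algebras"
    "HOL-Computational_Algebra.Fundamental_Theorem_Algebra"
begin

text \<open>
  A hyperplane \<open>I\<close> that contains all \<open>dot x y\<close> and all \<open>tri x y\<close> is an ideal, and the quotient by it
  is trivial (\<open>hyperplane_ideal\<close>). So the claim is that some nonzero real functional kills both
  products.

  As \<open>dot\<close> is nilpotent, there are nonzero functionals that kill \<open>dot\<close>. On the complex valued ones
  the Lie algebra of \<open>circ\<close> acts by precomposition with \<open>tri x\<close>. It is nilpotent, so by Lie's theorem
  (\<open>nilpotent_common_eigenvector\<close>) there is a common eigenvector: a functional \<open>\<xi> \<noteq> 0\<close> with
  \<open>\<xi> (dot x y) = 0\<close> and \<open>\<xi> (tri x y) = \<kappa> x * \<xi> y\<close>. If \<open>\<kappa> = 0\<close>, the real or the imaginary part of \<open>\<xi>\<close> is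
  the functional that is sought. Otherwise \<open>\<xi>\<close> is a \<open>1\<close>-cocycle of \<open>circ\<close> with values in the nontrivial
  character \<open>\<kappa>\<close>, and nilpotency of \<open>circ\<close> makes it a coboundary, that is, a multiple of \<open>\<kappa>\<close>
  (\<open>eigenvalue_multiplicative\<close>). So \<open>\<kappa>\<close> is linear and \<open>\<kappa> (tri x y) = \<kappa> x * \<kappa> y\<close>.

  Integrability excludes such a \<open>\<kappa> \<noteq> 0\<close> (\<open>character_trivial\<close>). Let \<open>dlam g\<close> be the differential of
  \<open>\<lambda>\<^sub>g\<close> at the identity. The eigenvector equation integrates to \<open>\<kappa> (dlam g y) = \<mu> g * \<kappa> y\<close> for a function
  \<open>\<mu>\<close> on the group without zeros, which is multiplicative for the second product. Now
  \<open>g \<circ> h = g \<cdot> \<lambda>\<^sub>g(h)\<close>: the two left translations by \<open>g\<close> differ by \<open>\<lambda>\<^sub>g\<close>, and \<open>\<mu> g\<close> is exactly the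
  factor that this causes. Hence with respect to the first product the derivative of \<open>\<mu>\<close> is left
  invariant, with value \<open>\<kappa>\<close> at the identity, so that \<open>\<mu> - 1\<close> is a homomorphism from the first group to
  the additive group of complex numbers. Its range is therefore closed under addition, negation and
  multiplication, it omits \<open>-1\<close>, and it contains a curve through \<open>0\<close> whose velocity is any given value
  of \<open>\<kappa>\<close>. Such a range is either a nontrivial connected subgroup of the real line or, by an open
  mapping argument, a neighbourhood of \<open>0\<close>; in both cases it contains \<open>-1\<close> after all.
\<close>

section \<open>Calculus of smooth maps between normed spaces\<close>

text \<open>The closure properties below go by induction on the order: the derivative of a sum, product or
  composite is built from functions that are differentiable one time less. Openness of the domain is
  what makes derivatives at a point depend only on the values in the domain.\<close>

lemma times_differentiable_on_subset:
  "times_differentiable_on k S f \<Longrightarrow> T \<subseteq> S \<Longrightarrow> times_differentiable_on k T f"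
  by (induction k arbitrary: f) (auto intro: continuous_on_subset)

lemma times_differentiable_on_cong:
  assumes "times_differentiable_on k S f" "open S" "\<And>x. x \<in> S \<Longrightarrow> f x = g x"
  shows "times_differentiable_on k S g"
  using assms
proof (induction k arbitrary: f g)
  case 0
  then show ?case by (auto cong: continuous_on_cong)
next
  case (Suc k)
  have "g differentiable (at x)" if "x \<in> S" for x
    using Suc.prems that has_derivative_transform_within_open
    unfolding differentiable_def times_differentiable_on.simps by metis
  moreover have "times_differentiable_on k S (\<lambda>x. frechet_derivative g (at x) v)" for v
  proof (rule Suc.IH)
    show "times_differentiable_on k S (\<lambda>x. frechet_derivative f (at x) v)"
      using Suc.prems(1) by simp
    show "open S" by fact
    show "frechet_derivative f (at x) v = frechet_derivative g (at x) v" if "x \<in> S" for x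
      using frechet_derivative_transform_within_open[of f x S g] Suc.prems that by simp
  qed
  ultimately show ?case by simp
qed

lemma times_differentiable_on_continuous:
  "times_differentiable_on k S f \<Longrightarrow> continuous_on S f"
  by (cases k) (auto intro!: continuous_at_imp_continuous_on differentiable_imp_continuous_within)

lemma times_differentiable_on_lower:
  "times_differentiable_on (Suc k) S f \<Longrightarrow> times_differentiable_on k S f"
proof (induction k arbitrary: f)
  case 0
  then show ?case using times_differentiable_on_continuous[of "Suc 0" S f] by simp
next
  case (Suc k)
  have "times_differentiable_on k S (\<lambda>x. frechet_derivative f (at x) v)" for v
    by (rule Suc.IH) (use Suc.prems in simp)
  then show ?case using Suc.prems by simp
qed

lemma times_differentiable_on_local:
  assumes "\<And>x. x \<in> S \<Longrightarrow> \<exists>N. open N \<and> x \<in> N \<and> times_differentiable_on k N f"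
  shows "times_differentiable_on k S f"
  using assms
proof (induction k arbitrary: f)
  case 0
  have "isCont f x" if "x \<in> S" for x
    using 0[OF that] continuous_on_eq_continuous_at by auto
  then show ?case by (simp add: continuous_at_imp_continuous_on)
next
  case (Suc k)
  have "times_differentiable_on k S (\<lambda>x. frechet_derivative f (at x) v)" for v
    by (rule Suc.IH) (use Suc.prems in fastforce)
  then show ?case using Suc.prems by fastforce
qed

lemma times_differentiable_on_const: "times_differentiable_on k S (\<lambda>x. c)"
  by (induction k arbitrary: c) auto

lemma times_differentiable_on_bounded_linear:
  assumes "bounded_linear L" shows "times_differentiable_on k S L"
proof (cases k)
  case 0
  then show ?thesis
    using assms by (simp add: linear_continuous_on)
next
  case (Suc m)
  have D: "(L has_derivative L) (at x)" for x
    using assms by (rule bounded_linear_imp_has_derivative)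
  have "frechet_derivative L (at x) = L" for x
    using frechet_derivative_at[OF D] by simp
  then show ?thesis
    using D by (auto simp: Suc times_differentiable_on_const differentiable_def)
qed

lemma times_differentiable_on_add:
  assumes "times_differentiable_on k S f" "times_differentiable_on k S g" "open S"
  shows "times_differentiable_on k S (\<lambda>x. f x + g x)"
  using assms
proof (induction k arbitrary: f g)
  case 0
  then show ?case by (auto intro: continuous_on_add)
next
  case (Suc k)
  have D: "((\<lambda>x. f x + g x) has_derivative
      (\<lambda>v. frechet_derivative f (at x) v + frechet_derivative g (at x) v)) (at x)" if "x \<in> S" for x
    using Suc.prems that
    by (intro has_derivative_add) (auto simp: frechet_derivative_works[symmetric])
  have "times_differentiable_on k S (\<lambda>x. frechet_derivative (\<lambda>x. f x + g x) (at x) v)" for v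
  proof (rule times_differentiable_on_cong)
    show "times_differentiable_on k S
        (\<lambda>x. frechet_derivative f (at x) v + frechet_derivative g (at x) v)"
      using Suc.prems by (intro Suc.IH) auto
  qed (use Suc.prems frechet_derivative_at[OF D] in \<open>auto simp: fun_eq_iff\<close>)
  then show ?case using D by (auto simp: differentiable_def)
qed

lemma times_differentiable_on_sum:
  assumes "\<And>i. i \<in> I \<Longrightarrow> times_differentiable_on k S (f i)" "open S"
  shows "times_differentiable_on k S (\<lambda>x. \<Sum>i\<in>I. f i x)"
  using assms
  by (induction I rule: infinite_finite_induct)
    (auto intro: times_differentiable_on_const times_differentiable_on_add)

lemma times_differentiable_on_bilinear:
  assumes B: "bounded_bilinear B"
    and "times_differentiable_on k S f" "times_differentiable_on k S g" "open S"
  shows "times_differentiable_on k S (\<lambda>x. B (f x) (g x))"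
  using assms(2-)
proof (induction k arbitrary: f g)
  case 0
  then show ?case by (auto intro: bounded_bilinear.continuous_on[OF B])
next
  case (Suc k)
  have D: "((\<lambda>x. B (f x) (g x)) has_derivative
      (\<lambda>v. B (f x) (frechet_derivative g (at x) v) + B (frechet_derivative f (at x) v) (g x))) (at x)"
    if "x \<in> S" for x
    using Suc.prems that
    by (intro bounded_bilinear.FDERIV[OF B]) (auto simp: frechet_derivative_works[symmetric])
  have "times_differentiable_on k S (\<lambda>x. frechet_derivative (\<lambda>x. B (f x) (g x)) (at x) v)" for v
  proof (rule times_differentiable_on_cong)
    show "times_differentiable_on k S (\<lambda>x. B (f x) (frechet_derivative g (at x) v)
        + B (frechet_derivative f (at x) v) (g x))"
      using Suc.prems times_differentiable_on_lower[of k S f] times_differentiable_on_lower[of k S g]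
      by (intro times_differentiable_on_add Suc.IH) auto
  qed (use Suc.prems frechet_derivative_at[OF D] in \<open>auto simp: fun_eq_iff\<close>)
  then show ?case using D by (auto simp: differentiable_def)
qed

text \<open>The chain rule expresses \<open>D(f \<circ> g)(x) v\<close> as the sum of the products of the coordinates of
  \<open>Dg(x) v\<close> with the partial derivatives of \<open>f\<close> at \<open>g x\<close>; the latter are again compositions,
  of a map that is differentiable one time less.\<close>

lemma times_differentiable_on_compose:
  fixes g :: "'d::real_normed_vector \<Rightarrow> 'e::euclidean_space" and f :: "'e \<Rightarrow> 'f::real_normed_vector"
  assumes "times_differentiable_on k S g" "times_differentiable_on k T f"
    and "open S" "open T" "g ` S \<subseteq> T"
  shows "times_differentiable_on k S (f \<circ> g)"
  using assms
proof (induction k arbitrary: f)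
  case 0
  then show ?case
    using continuous_on_compose[of S g f] continuous_on_subset[of T f "g ` S"]
    by (simp add: comp_def)
next
  case (Suc k)
  have g: "(g has_derivative frechet_derivative g (at x)) (at x)" if "x \<in> S" for x
    using Suc.prems that by (simp add: frechet_derivative_works[symmetric])
  have f: "(f has_derivative frechet_derivative f (at (g x))) (at (g x))" if "x \<in> S" for x
  proof -
    have "g x \<in> T" using Suc.prems that by blast
    then show ?thesis using Suc.prems by (simp add: frechet_derivative_works[symmetric])
  qed
  have D: "(f \<circ> g has_derivative frechet_derivative f (at (g x)) \<circ> frechet_derivative g (at x)) (at x)"
    if "x \<in> S" for x
    using diff_chain_at[OF g f] that by simp
  have "times_differentiable_on k S (\<lambda>x. frechet_derivative (f \<circ> g) (at x) v)" for v
  proof (rule times_differentiable_on_cong)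
    show "times_differentiable_on k S (\<lambda>x. \<Sum>b\<in>Basis. (frechet_derivative g (at x) v \<bullet> b) *\<^sub>R
        ((\<lambda>y. frechet_derivative f (at y) b) \<circ> g) x)"
    proof (intro times_differentiable_on_sum times_differentiable_on_bilinear[OF bounded_bilinear_scaleR]
        Suc.IH Suc.prems)
      show "times_differentiable_on k S (\<lambda>x. frechet_derivative g (at x) v \<bullet> b)" for b
        using Suc.prems
        by (intro times_differentiable_on_bilinear[OF bounded_bilinear_inner] times_differentiable_on_const) auto
    qed (use Suc.prems times_differentiable_on_lower[of k S g] in auto)
  next
    fix x assume x: "x \<in> S"
    let ?w = "frechet_derivative g (at x) v"
    have lin: "linear (frechet_derivative f (at (g x)))"
      using f[OF x] by (rule has_derivative_linear)
    have "frechet_derivative f (at (g x)) ?w = frechet_derivative f (at (g x)) (\<Sum>b\<in>Basis. (?w \<bullet> b) *\<^sub>R b)"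
      by (simp add: euclidean_representation)
    also have "\<dots> = (\<Sum>b\<in>Basis. (?w \<bullet> b) *\<^sub>R frechet_derivative f (at (g x)) b)"
      by (simp add: linear_sum[OF lin] linear_cmul[OF lin])
    finally show "(\<Sum>b\<in>Basis. (?w \<bullet> b) *\<^sub>R ((\<lambda>y. frechet_derivative f (at y) b) \<circ> g) x)
        = frechet_derivative (f \<circ> g) (at x) v"
      by (simp flip: frechet_derivative_at[OF D[OF x]])
  qed (use Suc.prems in auto)
  moreover have "f \<circ> g differentiable (at x)" if "x \<in> S" for x
    using D[OF that] unfolding differentiable_def by blast
  ultimately show ?case by (simp only: times_differentiable_on.simps) blast
qed

lemma smooth_on_subset: "smooth_on S f \<Longrightarrow> T \<subseteq> S \<Longrightarrow> smooth_on T f"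
  unfolding smooth_on_def using times_differentiable_on_subset by blast

lemma smooth_on_cong: "smooth_on S f \<Longrightarrow> open S \<Longrightarrow> (\<And>x. x \<in> S \<Longrightarrow> f x = g x) \<Longrightarrow> smooth_on S g"
  unfolding smooth_on_def using times_differentiable_on_cong by blast

lemma smooth_on_local:
  "(\<And>x. x \<in> S \<Longrightarrow> \<exists>N. open N \<and> x \<in> N \<and> smooth_on N f) \<Longrightarrow> smooth_on S f"
  unfolding smooth_on_def using times_differentiable_on_local by meson

lemma smooth_on_continuous: "smooth_on S f \<Longrightarrow> continuous_on S f"
  unfolding smooth_on_def using times_differentiable_on_continuous by blast

lemma smooth_on_differentiable: "smooth_on S f \<Longrightarrow> x \<in> S \<Longrightarrow> f differentiable (at x)"
  unfolding smooth_on_def using times_differentiable_on.simps(2)[of 0 S f] by blast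

lemma smooth_on_frechet_derivative:
  "smooth_on S f \<Longrightarrow> smooth_on S (\<lambda>x. frechet_derivative f (at x) v)"
  unfolding smooth_on_def using times_differentiable_on.simps(2) by blast

lemma smooth_on_const: "smooth_on S (\<lambda>x. c)"
  unfolding smooth_on_def using times_differentiable_on_const by blast

lemma smooth_on_bounded_linear: "bounded_linear L \<Longrightarrow> smooth_on S L"
  unfolding smooth_on_def using times_differentiable_on_bounded_linear by blast

lemma smooth_on_add:
  "smooth_on S f \<Longrightarrow> smooth_on S g \<Longrightarrow> open S \<Longrightarrow> smooth_on S (\<lambda>x. f x + g x)"
  unfolding smooth_on_def using times_differentiable_on_add by blast

lemma smooth_on_compose:
  fixes g :: "'d::real_normed_vector \<Rightarrow> 'e::euclidean_space"
  shows "smooth_on S g \<Longrightarrow> smooth_on T f \<Longrightarrow> open S \<Longrightarrow> open T \<Longrightarrow> g ` S \<subseteq> T \<Longrightarrow> smooth_on S (f \<circ> g)"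
  unfolding smooth_on_def using times_differentiable_on_compose by blast

lemma smooth_on_Pair:
  fixes f :: "'d::real_normed_vector \<Rightarrow> 'e::euclidean_space" and g :: "'d \<Rightarrow> 'f::euclidean_space"
  assumes "smooth_on S f" "smooth_on S g" "open S"
  shows "smooth_on S (\<lambda>x. (f x, g x))"
proof -
  have "bounded_linear (\<lambda>a. (a, 0) :: 'e \<times> 'f)" "bounded_linear (\<lambda>b. (0, b) :: 'e \<times> 'f)"
    by (intro bounded_linear_Pair bounded_linear_ident bounded_linear_zero)+
  then have "smooth_on S ((\<lambda>a. (a, 0) :: 'e \<times> 'f) \<circ> f)" "smooth_on S ((\<lambda>b. (0, b) :: 'e \<times> 'f) \<circ> g)"
    using assms by (auto intro: smooth_on_compose[where T=UNIV] smooth_on_bounded_linear)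
  from smooth_on_add[OF this \<open>open S\<close>] show ?thesis by simp
qed

section \<open>Smooth maps between manifolds\<close>

text \<open>An atlas without the compatibility of its charts. Compositions of smooth maps need one chart at
  each point and no more, and this form passes to products at once.\<close>

definition topological_atlas ::
  "('a::topological_space, 'e::euclidean_space) chart set \<Rightarrow> bool" where
  "topological_atlas A \<longleftrightarrow> (\<Union>(U, \<phi>)\<in>A. U) = UNIV \<and>
     (\<forall>(U, \<phi>)\<in>A. open U \<and> open (\<phi> ` U) \<and> homeomorphism U (\<phi> ` U) \<phi> (inv_into U \<phi>))"

lemma smooth_atlas_topological: "smooth_atlas A \<Longrightarrow> topological_atlas A"
  by (auto simp: smooth_atlas_def topological_atlas_def)

lemma topological_atlas_standard: "topological_atlas standard_atlas"
  by (auto simp: topological_atlas_def standard_atlas_def homeomorphism_def continuous_on_id)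

lemma chart_around:
  assumes "topological_atlas A"
  obtains U \<phi> where "(U, \<phi>) \<in> A" "p \<in> U"
  using assms unfolding topological_atlas_def by fastforce

lemma
  assumes "topological_atlas A" "(U, \<phi>) \<in> A"
  shows chart_open: "open U"
    and chart_open_image: "open (\<phi> ` U)"
    and chart_inj: "inj_on \<phi> U"
    and chart_continuous: "continuous_on U \<phi>"
    and chart_continuous_inv: "continuous_on (\<phi> ` U) (inv_into U \<phi>)"
proof -
  have *: "open U \<and> open (\<phi> ` U) \<and> homeomorphism U (\<phi> ` U) \<phi> (inv_into U \<phi>)"
    using assms unfolding topological_atlas_def by fast
  then show "open U" "open (\<phi> ` U)" "continuous_on U \<phi>" "continuous_on (\<phi> ` U) (inv_into U \<phi>)"
    by (auto simp: homeomorphism_def)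
  show "inj_on \<phi> U"
    using * by (auto simp: homeomorphism_def intro: inj_on_inverseI)
qed

lemma chart_open_map:
  assumes "topological_atlas A" "(U, \<phi>) \<in> A" "open N"
  shows "open (\<phi> ` (N \<inter> U))"
proof -
  have "\<phi> ` (N \<inter> U) = \<phi> ` U \<inter> inv_into U \<phi> -` N"
    using chart_inj[OF assms(1,2)] by (auto simp: inv_into_f_f)
  also have "open \<dots>"
    using chart_continuous_inv[OF assms(1,2)] chart_open_image[OF assms(1,2)] assms(3)
    by (rule continuous_open_preimage)
  finally show ?thesis .
qed

lemma topological_atlas_prod:
  assumes A: "topological_atlas A" and B: "topological_atlas B"
  shows "topological_atlas (prod_atlas A B)"
  unfolding topological_atlas_def
proof (intro conjI)
  show "(\<Union>(U, \<phi>)\<in>prod_atlas A B. U) = UNIV"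
  proof -
    have "z \<in> (\<Union>(U, \<phi>)\<in>prod_atlas A B. U)" for z :: "'a \<times> 'c"
    proof -
    obtain U \<phi> where 1: "(U, \<phi>) \<in> A" "fst z \<in> U" by (rule chart_around[OF A])
    obtain V \<psi> where 2: "(V, \<psi>) \<in> B" "snd z \<in> V" by (rule chart_around[OF B])
    have "(U \<times> V, map_prod \<phi> \<psi>) \<in> prod_atlas A B" "z \<in> U \<times> V"
      using 1 2 by (auto simp: prod_atlas_def mem_Times_iff)
    then show ?thesis by fast
    qed
    then show ?thesis by blast
  qed
  have "open (U \<times> V) \<and> open (map_prod \<phi> \<psi> ` (U \<times> V)) \<and>
      homeomorphism (U \<times> V) (map_prod \<phi> \<psi> ` (U \<times> V)) (map_prod \<phi> \<psi>) (inv_into (U \<times> V) (map_prod \<phi> \<psi>))"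
    if 1: "(U, \<phi>) \<in> A" and 2: "(V, \<psi>) \<in> B" for U \<phi> V \<psi>
  proof (intro conjI)
    have inj: "inj_on (map_prod \<phi> \<psi>) (U \<times> V)"
      using chart_inj[OF A 1] chart_inj[OF B 2] by (rule map_prod_inj_on)
    have eq: "inv_into (U \<times> V) (map_prod \<phi> \<psi>) z = map_prod (inv_into U \<phi>) (inv_into V \<psi>) z"
      if "z \<in> \<phi> ` U \<times> \<psi> ` V" for z
      using that chart_inj[OF A 1] chart_inj[OF B 2]
      by (intro inv_into_f_eq[OF inj]) (auto simp: inv_into_into f_inv_into_f)
    have im: "map_prod \<phi> \<psi> ` (U \<times> V) = \<phi> ` U \<times> \<psi> ` V" by force
    show "open (U \<times> V)" "open (map_prod \<phi> \<psi> ` (U \<times> V))"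
      unfolding im using chart_open[OF A 1] chart_open[OF B 2] chart_open_image[OF A 1] chart_open_image[OF B 2]
      by (auto intro: open_Times)
    have "continuous_on (U \<times> V) (map_prod \<phi> \<psi>)"
      unfolding map_prod_def case_prod_beta
      by (intro continuous_on_Pair continuous_on_compose2[OF chart_continuous[OF A 1]]
          continuous_on_compose2[OF chart_continuous[OF B 2]] continuous_on_fst continuous_on_snd
          continuous_on_id) auto
    moreover have "continuous_on (\<phi> ` U \<times> \<psi> ` V) (map_prod (inv_into U \<phi>) (inv_into V \<psi>))"
      unfolding map_prod_def case_prod_beta
      by (intro continuous_on_Pair continuous_on_compose2[OF chart_continuous_inv[OF A 1]]
          continuous_on_compose2[OF chart_continuous_inv[OF B 2]] continuous_on_fst continuous_on_snd
          continuous_on_id) auto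
    then have "continuous_on (\<phi> ` U \<times> \<psi> ` V) (inv_into (U \<times> V) (map_prod \<phi> \<psi>))"
      using eq by (simp cong: continuous_on_cong)
    ultimately show "homeomorphism (U \<times> V) (map_prod \<phi> \<psi> ` (U \<times> V)) (map_prod \<phi> \<psi>) (inv_into (U \<times> V) (map_prod \<phi> \<psi>))"
      unfolding homeomorphism_def im[symmetric]
      by (simp add: inv_into_image_cancel[OF inj] inv_into_f_f[OF inj] f_inv_into_f)
  qed
  then show "\<forall>(U, \<phi>)\<in>prod_atlas A B. open U \<and> open (\<phi> ` U) \<and> homeomorphism U (\<phi> ` U) \<phi> (inv_into U \<phi>)"
    unfolding prod_atlas_def by blast
qed

lemma inv_into_prod_chart:
  assumes "topological_atlas A" "(U, \<phi>) \<in> A" "topological_atlas B" "(V, \<psi>) \<in> B" "p \<in> U" "q \<in> V"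
  shows "inv_into (U \<times> V) (map_prod \<phi> \<psi>) (\<phi> p, \<psi> q) = (p, q)"
  using assms
  by (intro inv_into_f_eq map_prod_inj_on) (auto intro: chart_inj)

lemma smooth_map_onD:
  assumes "smooth_map_on A B N F" "(U, \<phi>) \<in> A" "(V, \<psi>) \<in> B"
  shows "smooth_on (\<phi> ` (N \<inter> U \<inter> F -` V)) (\<psi> \<circ> F \<circ> inv_into U \<phi>)"
  using assms unfolding smooth_map_on_def by fast

lemma smooth_map_onI:
  assumes "continuous_on N F"
    and "\<And>U \<phi> V \<psi>. (U, \<phi>) \<in> A \<Longrightarrow> (V, \<psi>) \<in> B \<Longrightarrow> smooth_on (\<phi> ` (N \<inter> U \<inter> F -` V)) (\<psi> \<circ> F \<circ> inv_into U \<phi>)"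
  shows "smooth_map_on A B N F"
  using assms unfolding smooth_map_on_def by fast

lemma smooth_map_on_continuous: "smooth_map_on A B N F \<Longrightarrow> continuous_on N F"
  by (simp add: smooth_map_on_def)

lemma smooth_map_on_subset:
  "smooth_map_on A B N F \<Longrightarrow> N' \<subseteq> N \<Longrightarrow> smooth_map_on A B N' F"
  by (rule smooth_map_onI)
    (auto intro: smooth_on_subset[OF smooth_map_onD] continuous_on_subset dest: smooth_map_on_continuous)

text \<open>Near \<open>p\<close> a chart of \<open>B\<close> around \<open>F p\<close> is inserted between the two maps.\<close>

lemma smooth_map_on_compose:
  assumes A: "topological_atlas A" and B: "topological_atlas B" and C: "topological_atlas C"
    and F: "smooth_map_on A B N F" and F': "smooth_map_on B C N' F'"
    and "open N" "open N'" and sub: "F ` N \<subseteq> N'"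
  shows "smooth_map_on A C N (\<lambda>p. F' (F p))"
proof (rule smooth_map_onI)
  note cont = smooth_map_on_continuous[OF F] smooth_map_on_continuous[OF F']
  show cont_comp: "continuous_on N (\<lambda>p. F' (F p))"
    using cont(2,1) sub by (rule continuous_on_compose2)
  fix U \<phi> W \<eta> assume U: "(U, \<phi>) \<in> A" and W: "(W, \<eta>) \<in> C"
  show "smooth_on (\<phi> ` (N \<inter> U \<inter> (\<lambda>p. F' (F p)) -` W)) (\<eta> \<circ> (\<lambda>p. F' (F p)) \<circ> inv_into U \<phi>)"
  proof (rule smooth_on_local)
    fix x assume "x \<in> \<phi> ` (N \<inter> U \<inter> (\<lambda>p. F' (F p)) -` W)"
    then obtain p where p: "p \<in> N" "p \<in> U" "F' (F p) \<in> W" "x = \<phi> p" by auto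
    obtain V \<psi> where V: "(V, \<psi>) \<in> B" "F p \<in> V" by (rule chart_around[OF B])
    define P where "P = (N \<inter> F -` V) \<inter> (N \<inter> (\<lambda>p. F' (F p)) -` W)"
    have "open P"
      unfolding P_def using cont(1) cont_comp chart_open[OF B V(1)] chart_open[OF C W] \<open>open N\<close>
      by (intro open_Int continuous_open_preimage) auto
    then have oX: "open (\<phi> ` (P \<inter> U))" by (rule chart_open_map[OF A U])
    have "open (N' \<inter> F' -` W)"
      using cont(2) \<open>open N'\<close> chart_open[OF C W] by (intro continuous_open_preimage) auto
    then have oY: "open (\<psi> ` ((N' \<inter> F' -` W) \<inter> V))" by (rule chart_open_map[OF B V(1)])
    have "smooth_on (\<phi> ` (P \<inter> U)) ((\<eta> \<circ> F' \<circ> inv_into V \<psi>) \<circ> (\<psi> \<circ> F \<circ> inv_into U \<phi>))"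
    proof (rule smooth_on_compose[OF _ _ oX oY])
      show "smooth_on (\<phi> ` (P \<inter> U)) (\<psi> \<circ> F \<circ> inv_into U \<phi>)"
        by (rule smooth_on_subset[OF smooth_map_onD[OF F U V(1)]]) (auto simp: P_def)
      show "smooth_on (\<psi> ` ((N' \<inter> F' -` W) \<inter> V)) (\<eta> \<circ> F' \<circ> inv_into V \<psi>)"
        by (rule smooth_on_subset[OF smooth_map_onD[OF F' V(1) W]]) auto
      show "(\<psi> \<circ> F \<circ> inv_into U \<phi>) ` \<phi> ` (P \<inter> U) \<subseteq> \<psi> ` ((N' \<inter> F' -` W) \<inter> V)"
        using sub chart_inj[OF A U] by (auto simp: P_def inv_into_f_f)
    qed
    then have "smooth_on (\<phi> ` (P \<inter> U)) (\<eta> \<circ> (\<lambda>p. F' (F p)) \<circ> inv_into U \<phi>)"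
      by (rule smooth_on_cong[OF _ oX])
        (use chart_inj[OF A U] chart_inj[OF B V(1)] in \<open>auto simp: P_def inv_into_f_f\<close>)
    moreover have "x \<in> \<phi> ` (P \<inter> U)" using p V by (auto simp: P_def)
    ultimately show "\<exists>X. open X \<and> x \<in> X \<and> smooth_on X (\<eta> \<circ> (\<lambda>p. F' (F p)) \<circ> inv_into U \<phi>)"
      using oX by blast
  qed
qed

lemma smooth_map_on_const: "smooth_map_on A B N (\<lambda>p. c)"
proof (rule smooth_map_onI)
  show "smooth_on (\<phi> ` (N \<inter> U \<inter> (\<lambda>p. c) -` V)) (\<psi> \<circ> (\<lambda>p. c) \<circ> inv_into U \<phi>)" for U \<phi> V \<psi>
    by (simp add: comp_def smooth_on_const)
qed simp

lemma transition_smooth: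
  assumes "smooth_atlas A" "(U, \<phi>) \<in> A" "(V, \<psi>) \<in> A"
  shows "smooth_on (\<phi> ` (U \<inter> V)) (\<psi> \<circ> inv_into U \<phi>)"
  using assms unfolding smooth_atlas_def by fast

lemma smooth_map_on_ident:
  assumes "smooth_atlas A" shows "smooth_map_on A A N (\<lambda>p. p)"
proof (rule smooth_map_onI)
  fix U \<phi> V \<psi> assume "(U, \<phi>) \<in> A" "(V, \<psi>) \<in> A"
  from transition_smooth[OF assms this]
  have "smooth_on (\<phi> ` (N \<inter> U \<inter> V)) (\<psi> \<circ> inv_into U \<phi>)"
    by (rule smooth_on_subset) auto
  then show "smooth_on (\<phi> ` (N \<inter> U \<inter> (\<lambda>p. p) -` V)) (\<psi> \<circ> (\<lambda>p. p) \<circ> inv_into U \<phi>)"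
    by (simp add: comp_def)
qed simp

lemma smooth_map_on_fst:
  assumes A: "smooth_atlas A" and B: "topological_atlas B"
  shows "smooth_map_on (prod_atlas A B) A N fst"
proof (rule smooth_map_onI)
  show "continuous_on N fst" by (intro continuous_intros)
  fix P \<pi> V \<psi> assume "(P, \<pi>) \<in> prod_atlas A B" and V: "(V, \<psi>) \<in> A"
  then obtain U \<phi> W \<omega> where P: "P = U \<times> W" "\<pi> = map_prod \<phi> \<omega>" and U: "(U, \<phi>) \<in> A" and W: "(W, \<omega>) \<in> B"
    by (auto simp: prod_atlas_def)
  note At = smooth_atlas_topological[OF A]
  have o1: "open (\<phi> ` (V \<inter> U))" and o2: "open (\<omega> ` W)"
    using chart_open_map[OF At U chart_open[OF At V]] chart_open_image[OF B W] by auto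
  have "smooth_on (\<phi> ` (U \<inter> V) \<times> \<omega> ` W) ((\<psi> \<circ> inv_into U \<phi>) \<circ> fst)"
    using o1 o2
    by (intro smooth_on_compose[OF smooth_on_bounded_linear[OF bounded_linear_fst] transition_smooth[OF A U V]])
      (auto simp: Int_commute intro: open_Times)
  then have "smooth_on (\<phi> ` (U \<inter> V) \<times> \<omega> ` W) (\<psi> \<circ> fst \<circ> inv_into P \<pi>)"
    by (rule smooth_on_cong)
      (use o1 o2 in \<open>auto simp: P inv_into_prod_chart[OF At U B W] inv_into_f_f[OF chart_inj[OF At U]]
          Int_commute intro!: open_Times\<close>)
  then show "smooth_on (\<pi> ` (N \<inter> P \<inter> fst -` V)) (\<psi> \<circ> fst \<circ> inv_into P \<pi>)"
    by (rule smooth_on_subset) (auto simp: P)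
qed

lemma smooth_map_on_snd:
  assumes A: "topological_atlas A" and B: "smooth_atlas B"
  shows "smooth_map_on (prod_atlas A B) B N snd"
proof (rule smooth_map_onI)
  show "continuous_on N snd" by (intro continuous_intros)
  fix P \<pi> V \<psi> assume "(P, \<pi>) \<in> prod_atlas A B" and V: "(V, \<psi>) \<in> B"
  then obtain U \<phi> W \<omega> where P: "P = U \<times> W" "\<pi> = map_prod \<phi> \<omega>" and U: "(U, \<phi>) \<in> A" and W: "(W, \<omega>) \<in> B"
    by (auto simp: prod_atlas_def)
  note Bt = smooth_atlas_topological[OF B]
  have o1: "open (\<omega> ` (V \<inter> W))" and o2: "open (\<phi> ` U)"
    using chart_open_map[OF Bt W chart_open[OF Bt V]] chart_open_image[OF A U] by auto
  have "smooth_on (\<phi> ` U \<times> \<omega> ` (W \<inter> V)) ((\<psi> \<circ> inv_into W \<omega>) \<circ> snd)"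
    using o1 o2
    by (intro smooth_on_compose[OF smooth_on_bounded_linear[OF bounded_linear_snd] transition_smooth[OF B W V]])
      (auto simp: Int_commute intro: open_Times)
  then have "smooth_on (\<phi> ` U \<times> \<omega> ` (W \<inter> V)) (\<psi> \<circ> snd \<circ> inv_into P \<pi>)"
    by (rule smooth_on_cong)
      (use o1 o2 in \<open>auto simp: P inv_into_prod_chart[OF A U Bt W] inv_into_f_f[OF chart_inj[OF Bt W]]
          Int_commute intro!: open_Times\<close>)
  then show "smooth_on (\<pi> ` (N \<inter> P \<inter> snd -` V)) (\<psi> \<circ> snd \<circ> inv_into P \<pi>)"
    by (rule smooth_on_subset) (auto simp: P)
qed

lemma smooth_map_on_Pair:
  assumes A: "topological_atlas A" and B: "topological_atlas B" and C: "topological_atlas C"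
    and F: "smooth_map_on A B N F" and G: "smooth_map_on A C N G" and "open N"
  shows "smooth_map_on A (prod_atlas B C) N (\<lambda>p. (F p, G p))"
proof (rule smooth_map_onI)
  note cont = smooth_map_on_continuous[OF F] smooth_map_on_continuous[OF G]
  show "continuous_on N (\<lambda>p. (F p, G p))" using cont by (rule continuous_on_Pair)
  fix U \<phi> P \<pi> assume U: "(U, \<phi>) \<in> A" and "(P, \<pi>) \<in> prod_atlas B C"
  then obtain V \<psi> W \<omega> where P: "P = V \<times> W" "\<pi> = map_prod \<psi> \<omega>" and V: "(V, \<psi>) \<in> B" and W: "(W, \<omega>) \<in> C"
    by (auto simp: prod_atlas_def)
  define X where "X = \<phi> ` (((N \<inter> F -` V) \<inter> (N \<inter> G -` W)) \<inter> U)"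
  have "open X"
    unfolding X_def using cont \<open>open N\<close> chart_open[OF B V] chart_open[OF C W]
    by (intro chart_open_map[OF A U] open_Int continuous_open_preimage) auto
  moreover have "smooth_on X (\<psi> \<circ> F \<circ> inv_into U \<phi>)"
    by (rule smooth_on_subset[OF smooth_map_onD[OF F U V]]) (auto simp: X_def)
  moreover have "smooth_on X (\<omega> \<circ> G \<circ> inv_into U \<phi>)"
    by (rule smooth_on_subset[OF smooth_map_onD[OF G U W]]) (auto simp: X_def)
  ultimately have "smooth_on X (\<lambda>x. ((\<psi> \<circ> F \<circ> inv_into U \<phi>) x, (\<omega> \<circ> G \<circ> inv_into U \<phi>) x))"
    by (intro smooth_on_Pair)
  moreover have "\<phi> ` (N \<inter> U \<inter> (\<lambda>p. (F p, G p)) -` P) = X" by (auto simp: P X_def)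
  ultimately show "smooth_on (\<phi> ` (N \<inter> U \<inter> (\<lambda>p. (F p, G p)) -` P)) (\<pi> \<circ> (\<lambda>p. (F p, G p)) \<circ> inv_into U \<phi>)"
    by (simp add: comp_def P)
qed

lemma smooth_atlas_standard: "smooth_atlas standard_atlas"
proof -
  have "smooth_on UNIV (id :: 'a \<Rightarrow> 'a)" unfolding id_def by (rule smooth_on_bounded_linear[OF bounded_linear_ident])
  then show ?thesis
    using topological_atlas_standard
    by (auto simp: smooth_atlas_def topological_atlas_def standard_atlas_def comp_def)
qed

lemma smooth_map_on_standard: "smooth_map_on standard_atlas standard_atlas N f \<longleftrightarrow> smooth_on N f"
  by (auto simp: smooth_map_on_def standard_atlas_def comp_def dest: smooth_on_continuous)

lemma smooth_map_on_chart:
  assumes "smooth_atlas A" "(U, \<phi>) \<in> A"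
  shows "smooth_map_on A standard_atlas U \<phi>"
proof (rule smooth_map_onI)
  show "continuous_on U \<phi>"
    using assms by (auto intro: chart_continuous smooth_atlas_topological)
  fix V \<psi> W and \<eta> :: "'b \<Rightarrow> 'b" assume "(V, \<psi>) \<in> A" "(W, \<eta>) \<in> standard_atlas"
  then show "smooth_on (\<psi> ` (U \<inter> V \<inter> \<phi> -` W)) (\<eta> \<circ> \<phi> \<circ> inv_into V \<psi>)"
    using transition_smooth[OF assms(1) _ assms(2), of V \<psi>]
    by (auto simp: standard_atlas_def Int_commute)
qed

lemma smooth_map_on_chart_inverse:
  assumes "smooth_atlas A" "(U, \<phi>) \<in> A"
  shows "smooth_map_on standard_atlas A (\<phi> ` U) (inv_into U \<phi>)"
proof (rule smooth_map_onI)
  note At = smooth_atlas_topological[OF assms(1)]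
  show "continuous_on (\<phi> ` U) (inv_into U \<phi>)"
    using At assms(2) by (rule chart_continuous_inv)
  fix V \<psi> W and \<eta> :: "'b \<Rightarrow> 'b" assume V: "(V, \<psi>) \<in> A" and "(W, \<eta>) \<in> standard_atlas"
  then have W: "W = UNIV" "\<eta> = id" by (auto simp: standard_atlas_def)
  have "\<phi> ` U \<inter> inv_into U \<phi> -` V = \<phi> ` (U \<inter> V)"
    using chart_inj[OF At assms(2)] by (auto simp: inv_into_f_f)
  then show "smooth_on (\<eta> ` (\<phi> ` U \<inter> W \<inter> inv_into U \<phi> -` V)) (\<psi> \<circ> inv_into U \<phi> \<circ> inv_into W \<eta>)"
    using transition_smooth[OF assms V] by (simp add: W)
qed

lemma smooth_map_on_standardI:
  fixes A :: "('a::t2_space, 'e::euclidean_space) chart set" and f :: "'a \<Rightarrow> 'c::euclidean_space"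
  assumes A: "topological_atlas A" and "open N"
    and f: "\<And>U \<phi>. (U, \<phi>) \<in> A \<Longrightarrow> smooth_on (\<phi> ` (N \<inter> U)) (f \<circ> inv_into U \<phi>)"
  shows "smooth_map_on A standard_atlas N f"
proof (rule smooth_map_onI)
  show "continuous_on N f"
  proof (intro continuous_at_imp_continuous_on ballI)
    fix p assume "p \<in> N"
    obtain U \<phi> where U: "(U, \<phi>) \<in> A" "p \<in> U" by (rule chart_around[OF A])
    have "continuous_on (N \<inter> U) (\<lambda>q. (f \<circ> inv_into U \<phi>) (\<phi> q))"
      by (rule continuous_on_compose2[OF smooth_on_continuous[OF f[OF U(1)]]
            continuous_on_subset[OF chart_continuous[OF A U(1)]]]) auto
    then have "continuous_on (N \<inter> U) f"
      by (rule continuous_on_eq) (use chart_inj[OF A U(1)] in \<open>auto simp: inv_into_f_f\<close>)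
    then show "isCont f p"
      using \<open>p \<in> N\<close> U \<open>open N\<close> chart_open[OF A U(1)] by (simp add: continuous_on_eq_continuous_at open_Int)
  qed
  fix U \<phi> W and \<eta> :: "'c \<Rightarrow> 'c" assume "(U, \<phi>) \<in> A" "(W, \<eta>) \<in> standard_atlas"
  then show "smooth_on (\<phi> ` (N \<inter> U \<inter> f -` W)) (\<eta> \<circ> f \<circ> inv_into U \<phi>)"
    using f by (simp add: standard_atlas_def)
qed

lemma smooth_map_on_standardD:
  assumes "smooth_map_on A standard_atlas N f" "(U, \<phi>) \<in> A"
  shows "smooth_on (\<phi> ` (N \<inter> U)) (f \<circ> inv_into U \<phi>)"
  using smooth_map_onD[OF assms, of UNIV id] by (simp add: standard_atlas_def)

section \<open>Curves, derivatives and tangent vectors\<close>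

lemma smooth_near_compose:
  assumes A: "topological_atlas A" and B: "topological_atlas B"
    and F: "smooth_map_on A B N F" "open N" "p \<in> N" and f: "smooth_near B (F p) f"
  shows "smooth_near A p (\<lambda>q. f (F q))"
proof -
  obtain N' where N': "open N'" "F p \<in> N'" "smooth_map_on B standard_atlas N' f"
    using f by (auto simp: smooth_near_def)
  define M where "M = N \<inter> F -` N'"
  have M: "open M"
    unfolding M_def using smooth_map_on_continuous[OF F(1)] F(2) N'(1) by (rule continuous_open_preimage)
  have FM: "smooth_map_on A B M F"
    using F(1) by (rule smooth_map_on_subset) (simp add: M_def)
  have "F ` M \<subseteq> N'" by (auto simp: M_def)
  from smooth_map_on_compose[OF A B topological_atlas_standard FM N'(3) M N'(1) this]
  have "smooth_map_on A standard_atlas M (\<lambda>q. f (F q))" .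
  moreover have "p \<in> M" using F(3) N'(2) by (simp add: M_def)
  ultimately show ?thesis using M unfolding smooth_near_def by blast
qed

lemma smooth_curve_at_iff:
  "smooth_curve_at A p c \<longleftrightarrow> c 0 = p \<and> (\<exists>I. open I \<and> 0 \<in> I \<and> smooth_map_on standard_atlas A I c)"
proof
  assume "smooth_curve_at A p c"
  then obtain e where "c 0 = p" "e > 0" "smooth_map_on standard_atlas A {-e<..<e} c"
    unfolding smooth_curve_at_def by blast
  moreover from this have "open {-e<..<e}" "0 \<in> {-e<..<e}" by simp_all
  ultimately show "c 0 = p \<and> (\<exists>I. open I \<and> 0 \<in> I \<and> smooth_map_on standard_atlas A I c)" by blast
next
  assume "c 0 = p \<and> (\<exists>I. open I \<and> 0 \<in> I \<and> smooth_map_on standard_atlas A I c)"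
  then obtain I where I: "open I" "0 \<in> I" "smooth_map_on standard_atlas A I c" "c 0 = p" by blast
  then obtain e where "e > 0" "ball 0 e \<subseteq> I" using open_contains_ball by blast
  moreover have "ball 0 e = {-e<..<e}" by (auto simp: dist_real_def)
  ultimately have "smooth_map_on standard_atlas A {-e<..<e} c"
    using smooth_map_on_subset[OF I(3)] by simp
  with I(4) \<open>e > 0\<close> show "smooth_curve_at A p c" unfolding smooth_curve_at_def by blast
qed

lemma smooth_curve_at_compose:
  assumes A: "topological_atlas A" and B: "topological_atlas B"
    and c: "smooth_curve_at A p c" and F: "smooth_map_on A B N F" "open N" "p \<in> N"
  shows "smooth_curve_at B (F p) (\<lambda>t. F (c t))"
proof -
  obtain I where I: "open I" "0 \<in> I" "smooth_map_on standard_atlas A I c" "c 0 = p"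
    using c by (auto simp: smooth_curve_at_iff)
  define M where "M = I \<inter> c -` N"
  have M: "open M"
    unfolding M_def using smooth_map_on_continuous[OF I(3)] I(1) F(2) by (rule continuous_open_preimage)
  have cM: "smooth_map_on standard_atlas A M c"
    using I(3) by (rule smooth_map_on_subset) (simp add: M_def)
  have "c ` M \<subseteq> N" by (auto simp: M_def)
  from smooth_map_on_compose[OF topological_atlas_standard A B cM F(1) M F(2) this]
  have "smooth_map_on standard_atlas B M (\<lambda>t. F (c t))" .
  moreover have "0 \<in> M" using F(3) I by (simp add: M_def)
  ultimately show ?thesis using M I(4) unfolding smooth_curve_at_iff by blast
qed

text \<open>The straight lines of a chart supply a curve through every point in every direction.\<close>

lemma smooth_curve_at_line:
  assumes A: "smooth_atlas A" and U: "(U, \<phi>) \<in> A" and x: "x \<in> \<phi> ` U"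
  shows "smooth_curve_at A (inv_into U \<phi> x) (\<lambda>t. inv_into U \<phi> (x + t *\<^sub>R v))"
proof -
  note At = smooth_atlas_topological[OF A]
  have "smooth_on UNIV (\<lambda>t. x + t *\<^sub>R v)"
    by (intro smooth_on_add smooth_on_const smooth_on_bounded_linear bounded_linear_scaleR_left) simp
  then have "smooth_curve_at standard_atlas x (\<lambda>t. x + t *\<^sub>R v)"
    unfolding smooth_curve_at_iff smooth_map_on_standard by (intro conjI exI[of _ UNIV]) auto
  from smooth_curve_at_compose[OF topological_atlas_standard At this smooth_map_on_chart_inverse[OF A U]
      chart_open_image[OF At U] x]
  show ?thesis .
qed

text \<open>The predicate \<open>smooth_near\<close> concerns real functions. The functions for which the argument needs
  a derivative are complex valued, and one of them is a quotient; first order differentiability in the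
  charts is enough for them.\<close>

definition differentiable_at_point ::
  "('a::topological_space, 'e::euclidean_space) chart set \<Rightarrow> 'a \<Rightarrow> ('a \<Rightarrow> 'b::real_normed_vector) \<Rightarrow> bool" where
  "differentiable_at_point A p k \<longleftrightarrow>
     (\<forall>(U, \<phi>)\<in>A. p \<in> U \<longrightarrow> (k \<circ> inv_into U \<phi>) differentiable (at (\<phi> p)))"

lemma differentiable_at_pointD:
  "differentiable_at_point A p k \<Longrightarrow> (U, \<phi>) \<in> A \<Longrightarrow> p \<in> U \<Longrightarrow> (k \<circ> inv_into U \<phi>) differentiable (at (\<phi> p))"
  unfolding differentiable_at_point_def by fast

lemma smooth_near_differentiable:
  assumes "smooth_near A p f" shows "differentiable_at_point A p f"
proof -
  obtain N where N: "p \<in> N" "smooth_map_on A standard_atlas N f"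
    using assms by (auto simp: smooth_near_def)
  show ?thesis
    unfolding differentiable_at_point_def
    using smooth_on_differentiable[OF smooth_map_on_standardD[OF N(2)]] N(1) by auto
qed

lemma differentiable_at_point_curve:
  assumes A: "topological_atlas A" and k: "differentiable_at_point A p k" and c: "smooth_curve_at A p c"
    and U: "(U, \<phi>) \<in> A" "p \<in> U"
  obtains v where "((\<lambda>t. \<phi> (c t)) has_vector_derivative v) (at 0)"
    and "((\<lambda>t. k (c t)) has_vector_derivative frechet_derivative (k \<circ> inv_into U \<phi>) (at (\<phi> p)) v) (at 0)"
proof -
  obtain I where I: "open I" "0 \<in> I" "smooth_map_on standard_atlas A I c" "c 0 = p"
    using c by (auto simp: smooth_curve_at_iff)
  have S: "open (I \<inter> c -` U)"
    using smooth_map_on_continuous[OF I(3)] I(1) chart_open[OF A U(1)] by (rule continuous_open_preimage)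
  have "smooth_on (I \<inter> c -` U) (\<lambda>t. \<phi> (c t))"
    using smooth_map_onD[OF I(3) _ U(1), of UNIV id] by (simp add: standard_atlas_def comp_def)
  then have "(\<lambda>t. \<phi> (c t)) differentiable (at 0)"
    by (rule smooth_on_differentiable) (use I U in simp)
  then obtain v where v: "((\<lambda>t. \<phi> (c t)) has_vector_derivative v) (at 0)"
    using vector_derivative_works by blast
  have "((k \<circ> inv_into U \<phi>) has_derivative frechet_derivative (k \<circ> inv_into U \<phi>) (at (\<phi> p))) (at (\<phi> (c 0)))"
    using differentiable_at_pointD[OF k U] by (simp add: frechet_derivative_works I(4))
  from vector_derivative_diff_chain_within[OF v has_derivative_at_withinI[OF this]]
  have "((k \<circ> inv_into U \<phi>) \<circ> (\<lambda>t. \<phi> (c t)) has_vector_derivative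
      frechet_derivative (k \<circ> inv_into U \<phi>) (at (\<phi> p)) v) (at 0)" .
  then have "((\<lambda>t. k (c t)) has_vector_derivative frechet_derivative (k \<circ> inv_into U \<phi>) (at (\<phi> p)) v) (at 0)"
    by (rule has_vector_derivative_transform_within_open[OF _ S])
      (use I U chart_inj[OF A U(1)] in \<open>auto simp: inv_into_f_f\<close>)
  with v show ?thesis by (rule that)
qed

lemma differentiable_at_point_curve_differentiable:
  assumes "topological_atlas A" "differentiable_at_point A p k" "smooth_curve_at A p c"
  shows "(\<lambda>t. k (c t)) differentiable (at 0)"
proof -
  obtain U \<phi> where "(U, \<phi>) \<in> A" "p \<in> U" by (rule chart_around[OF assms(1)])
  from differentiable_at_point_curve[OF assms this] obtain w
    where "((\<lambda>t. k (c t)) has_vector_derivative w) (at 0)" .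
  then show ?thesis by (rule differentiableI_vector)
qed

lemma differentiable_at_point_isCont:
  fixes A :: "('a::t2_space, 'e::euclidean_space) chart set"
  assumes A: "topological_atlas A" and k: "differentiable_at_point A p k"
  shows "isCont k p"
proof -
  obtain U \<phi> where U: "(U, \<phi>) \<in> A" "p \<in> U" by (rule chart_around[OF A])
  have "isCont (k \<circ> inv_into U \<phi>) (\<phi> p)"
    using differentiable_at_pointD[OF k U] by (rule differentiable_imp_continuous_within)
  moreover have "isCont \<phi> p"
    using chart_continuous[OF A U(1)] chart_open[OF A U(1)] U(2)
    by (simp add: continuous_on_eq_continuous_at)
  ultimately have "isCont (\<lambda>q. (k \<circ> inv_into U \<phi>) (\<phi> q)) p"
    by (rule isCont_o2[rotated])
  moreover have "\<forall>\<^sub>F q in nhds p. (k \<circ> inv_into U \<phi>) (\<phi> q) = k q"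
    using eventually_nhds_in_open[OF chart_open[OF A U(1)] U(2)]
    by eventually_elim (use chart_inj[OF A U(1)] in \<open>simp add: inv_into_f_f\<close>)
  ultimately show ?thesis by (rule isCont_cong[THEN iffD1, rotated])
qed

text \<open>The neighbourhood is the preimage of a ball in a chart. It depends only on \<open>N\<close>, so that it serves
  all functions \<open>k\<close> at once.\<close>

lemma zero_derivative_locally_constant:
  assumes A: "smooth_atlas A" and "open N" "p \<in> N"
  obtains N' where "open N'" "p \<in> N'" "N' \<subseteq> N"
    and "\<And>k. (\<And>q. q \<in> N \<Longrightarrow> differentiable_at_point A q k) \<Longrightarrow>
      (\<And>q c. q \<in> N \<Longrightarrow> smooth_curve_at A q c \<Longrightarrow> ((\<lambda>t. k (c t)) has_vector_derivative 0) (at 0)) \<Longrightarrow>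
      (\<And>q. q \<in> N' \<Longrightarrow> (k q :: 'b::real_normed_vector) = k p)"
proof -
  note At = smooth_atlas_topological[OF A]
  obtain U \<phi> where U: "(U, \<phi>) \<in> A" "p \<in> U" by (rule chart_around[OF At])
  have "open (\<phi> ` (N \<inter> U))" "\<phi> p \<in> \<phi> ` (N \<inter> U)"
    using chart_open_map[OF At U(1) \<open>open N\<close>] U(2) assms(3) by auto
  then obtain r where r: "r > 0" "ball (\<phi> p) r \<subseteq> \<phi> ` (N \<inter> U)"
    using open_contains_ball by blast
  define N' where "N' = U \<inter> \<phi> -` ball (\<phi> p) r"
  have inj: "inj_on \<phi> U" using At U(1) by (rule chart_inj)
  show ?thesis
  proof (rule that)
    show "open N'"
      unfolding N'_def using chart_continuous[OF At U(1)] chart_open[OF At U(1)]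
      by (intro continuous_open_preimage) auto
    show "p \<in> N'" using U r by (simp add: N'_def)
    show "N' \<subseteq> N"
    proof
      fix q assume q: "q \<in> N'"
      then have "\<phi> q \<in> \<phi> ` (N \<inter> U)" using r(2) by (auto simp: N'_def)
      then show "q \<in> N" using q inj by (auto simp: N'_def inj_on_def)
    qed
    fix k :: "'a \<Rightarrow> 'b" and q
    assume diff: "\<And>q. q \<in> N \<Longrightarrow> differentiable_at_point A q k"
      and zero: "\<And>q c. q \<in> N \<Longrightarrow> smooth_curve_at A q c \<Longrightarrow> ((\<lambda>t. k (c t)) has_vector_derivative 0) (at 0)"
      and q: "q \<in> N'"
    have "((k \<circ> inv_into U \<phi>) has_derivative (\<lambda>h. 0)) (at x)" if x: "x \<in> ball (\<phi> p) r" for x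
    proof -
      obtain p' where p': "p' \<in> N" "p' \<in> U" "x = \<phi> p'" using x r(2) by blast
      let ?D = "frechet_derivative (k \<circ> inv_into U \<phi>) (at x)"
      have D: "((k \<circ> inv_into U \<phi>) has_derivative ?D) (at x)"
        using differentiable_at_pointD[OF diff[OF p'(1)] U(1) p'(2)]
        by (simp add: frechet_derivative_works p'(3))
      have "?D v = 0" for v
      proof -
        have "((\<lambda>t. x + t *\<^sub>R v) has_vector_derivative v) (at 0)"
          by (auto intro!: derivative_eq_intros)
        moreover have "((k \<circ> inv_into U \<phi>) has_derivative ?D)
            (at (x + 0 *\<^sub>R v) within (\<lambda>t. x + t *\<^sub>R v) ` UNIV)"
          using D by (simp add: has_derivative_at_withinI)
        ultimately have "((k \<circ> inv_into U \<phi>) \<circ> (\<lambda>t. x + t *\<^sub>R v) has_vector_derivative ?D v) (at 0)"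
          by (rule vector_derivative_diff_chain_within)
        moreover have "((\<lambda>t. k (inv_into U \<phi> (x + t *\<^sub>R v))) has_vector_derivative 0) (at 0)"
        proof (rule zero[OF p'(1)])
          show "smooth_curve_at A p' (\<lambda>t. inv_into U \<phi> (x + t *\<^sub>R v))"
            using smooth_curve_at_line[OF A U(1), of x v] p' inj by (simp add: inv_into_f_f)
        qed
        ultimately show ?thesis
          unfolding comp_def by (rule vector_derivative_unique_at)
      qed
      then have "?D = (\<lambda>h. 0)" by (rule ext)
      with D show ?thesis by simp
    qed
    then have "(k \<circ> inv_into U \<phi>) (\<phi> q) = (k \<circ> inv_into U \<phi>) (\<phi> p)"
    proof (rule has_derivative_zero_unique[OF convex_ball has_derivative_at_withinI])
      show "\<phi> p \<in> ball (\<phi> p) r" "\<phi> q \<in> ball (\<phi> p) r"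
        using q r(1) by (simp_all add: N'_def)
    qed
    then show "k q = k p" using q U inj by (simp add: N'_def inv_into_f_f)
  qed
qed

lemma zero_derivative_constant:
  fixes k :: "'a::{t2_space,second_countable_topology} \<Rightarrow> 'b::real_normed_vector"
  assumes A: "smooth_atlas A" and "connected (UNIV :: 'a set)"
    and "\<And>q. differentiable_at_point A q k"
    and "\<And>q c. smooth_curve_at A q c \<Longrightarrow> ((\<lambda>t. k (c t)) has_vector_derivative 0) (at 0)"
  shows "k q = k p"
proof -
  have "\<exists>T. open T \<and> x \<in> T \<and> (\<forall>q\<in>T. k q = k x)" for x
  proof (rule zero_derivative_locally_constant[OF A open_UNIV UNIV_I[of x], where 'b='b])
    fix T assume "open T" "x \<in> T" and
      T: "\<And>k q. (\<And>q. q \<in> UNIV \<Longrightarrow> differentiable_at_point A q k) \<Longrightarrow>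
        (\<And>q c. q \<in> UNIV \<Longrightarrow> smooth_curve_at A q c \<Longrightarrow> ((\<lambda>t. k (c t)) has_vector_derivative 0) (at 0)) \<Longrightarrow>
        q \<in> T \<Longrightarrow> (k q :: 'b) = k x"
    have "k q = k x" if "q \<in> T" for q
      by (rule T[OF assms(3) assms(4) that])
    with \<open>open T\<close> \<open>x \<in> T\<close> show "\<exists>T. open T \<and> x \<in> T \<and> (\<forall>q\<in>T. k q = k x)" by blast
  qed
  then have "\<exists>T. openin (top_of_set UNIV) T \<and> x \<in> T \<and> (\<forall>q\<in>T. k q = k x)" for x
    by simp
  then have "k constant_on UNIV"
    using assms(2) by (rule locally_constant_imp_constant[rotated])
  then show ?thesis by (auto simp: constant_on_def)
qed

text \<open>In a chart of the first factor this is a partial derivative of a smooth function, restricted to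
  the slice \<open>s = 0\<close>.\<close>

lemma smooth_near_partial_derivative:
  fixes A :: "('a::{t2_space,second_countable_topology}, 'e::euclidean_space) chart set" and F :: "'a \<times> real \<Rightarrow> real"
  assumes A: "topological_atlas A" and F: "smooth_near (prod_atlas A standard_atlas) (p, 0) F"
  shows "smooth_near A p (\<lambda>g. deriv (\<lambda>s. F (g, s)) 0)"
proof -
  obtain N0 where N0: "open N0" "(p, 0) \<in> N0" "smooth_map_on (prod_atlas A standard_atlas) standard_atlas N0 F"
    using F by (auto simp: smooth_near_def)
  obtain N I where N: "open N" "p \<in> N" and I: "open I" "0 \<in> I" and sub: "N \<times> I \<subseteq> N0"
    using open_prod_elim[OF N0(1,2)] by (metis mem_Sigma_iff)
  have "smooth_map_on A standard_atlas N (\<lambda>g. deriv (\<lambda>s. F (g, s)) 0)"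
  proof (rule smooth_map_on_standardI[OF A \<open>open N\<close>])
    fix U \<phi> assume U: "(U, \<phi>) \<in> A"
    have chart: "(U \<times> UNIV, map_prod \<phi> id) \<in> prod_atlas A (standard_atlas :: (real, real) chart set)"
      using U by (auto simp: prod_atlas_def standard_atlas_def)
    define S where "S = \<phi> ` (N \<inter> U) \<times> I"
    have inj: "inj_on \<phi> U" using A U by (rule chart_inj)
    have oN: "open (\<phi> ` (N \<inter> U))" by (rule chart_open_map[OF A U \<open>open N\<close>])
    then have "open S" unfolding S_def using I(1) by (rule open_Times)
    define P where "P = (\<lambda>(x, s). F (inv_into U \<phi> x, s))"
    have "S \<subseteq> map_prod \<phi> id ` (N0 \<inter> U \<times> UNIV)"
      using sub by (auto simp: S_def intro!: image_eqI[where x = "(_, _)"])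
    then have "smooth_on S (F \<circ> inv_into (U \<times> UNIV) (map_prod \<phi> id))"
      by (rule smooth_on_subset[OF smooth_map_on_standardD[OF N0(3) chart]])
    then have P: "smooth_on S P"
    proof (rule smooth_on_cong[OF _ \<open>open S\<close>])
      fix z assume "z \<in> S"
      then obtain q s where "q \<in> U" "z = (\<phi> q, id s)" by (auto simp: S_def)
      moreover have "(UNIV, id) \<in> (standard_atlas :: (real, real) chart set)"
        by (simp add: standard_atlas_def)
      ultimately show "(F \<circ> inv_into (U \<times> UNIV) (map_prod \<phi> id)) z = P z"
        using inv_into_prod_chart[OF A U topological_atlas_standard, of UNIV id q s]
        by (simp add: P_def inv_into_f_f[OF inj])
    qed
    have "smooth_on (\<phi> ` (N \<inter> U)) ((\<lambda>z. frechet_derivative P (at z) (0, 1)) \<circ> (\<lambda>x. (x, 0)))"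
      using I(2) oN \<open>open S\<close>
      by (intro smooth_on_compose[OF _ smooth_on_frechet_derivative[OF P]] smooth_on_bounded_linear
          bounded_linear_Pair bounded_linear_ident bounded_linear_zero) (auto simp: S_def)
    then show "smooth_on (\<phi> ` (N \<inter> U)) ((\<lambda>g. deriv (\<lambda>s. F (g, s)) 0) \<circ> inv_into U \<phi>)"
    proof (rule smooth_on_cong[OF _ oN])
      fix x assume x: "x \<in> \<phi> ` (N \<inter> U)"
      let ?D = "frechet_derivative P (at (x, 0))"
      have "P differentiable (at (x, 0))"
        using x I by (intro smooth_on_differentiable[OF P]) (auto simp: S_def)
      then have D: "(P has_derivative ?D) (at (x, 0))" by (simp add: frechet_derivative_works)
      have "((\<lambda>s. (x, s)) has_vector_derivative (0, 1)) (at 0)"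
        by (auto intro!: derivative_eq_intros simp: has_vector_derivative_def)
      from vector_derivative_diff_chain_within[OF this has_derivative_at_withinI[OF D]]
      have "((\<lambda>s. F (inv_into U \<phi> x, s)) has_real_derivative ?D (0, 1)) (at 0)"
        by (simp add: P_def comp_def has_real_derivative_iff_has_vector_derivative)
      then show "((\<lambda>z. frechet_derivative P (at z) (0, 1)) \<circ> (\<lambda>x. (x, 0))) x =
          ((\<lambda>g. deriv (\<lambda>s. F (g, s)) 0) \<circ> inv_into U \<phi>) x"
        by (simp add: DERIV_imp_deriv)
    qed
  qed
  then show ?thesis using N by (auto simp: smooth_near_def)
qed

lemma differentiable_at_point_divide:
  fixes k1 k2 :: "'a::topological_space \<Rightarrow> complex"
  assumes A: "topological_atlas A"
    and k: "differentiable_at_point A p k1" "differentiable_at_point A p k2" "k2 p \<noteq> 0"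
  shows "differentiable_at_point A p (\<lambda>q. k1 q / k2 q)"
  unfolding differentiable_at_point_def
proof safe
  fix U \<phi> assume U: "(U, \<phi>) \<in> A" "p \<in> U"
  have "(k2 \<circ> inv_into U \<phi>) (\<phi> p) \<noteq> 0"
    using k(3) U chart_inj[OF A U(1)] by (simp add: inv_into_f_f)
  from differentiable_divide[OF differentiable_at_pointD[OF k(1) U] differentiable_at_pointD[OF k(2) U] this]
  show "(\<lambda>q. k1 q / k2 q) \<circ> inv_into U \<phi> differentiable at (\<phi> p)"
    by (simp add: comp_def)
qed

lemma differentiable_at_point_diff:
  assumes "differentiable_at_point A p k1" "differentiable_at_point A p k2"
  shows "differentiable_at_point A p (\<lambda>q. k1 q - k2 q)"
  using assms differentiable_diff
  unfolding differentiable_at_point_def comp_def by fast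

lemma differentiable_at_point_Complex:
  assumes "differentiable_at_point A p f1" "differentiable_at_point A p f2"
  shows "differentiable_at_point A p (\<lambda>q. Complex (f1 q) (f2 q))"
  unfolding differentiable_at_point_def
proof safe
  fix U \<phi> assume U: "(U, \<phi>) \<in> A" "p \<in> U"
  from differentiable_at_pointD[OF assms(1) U] differentiable_at_pointD[OF assms(2) U]
  obtain D1 D2 where "(f1 \<circ> inv_into U \<phi> has_derivative D1) (at (\<phi> p))"
    "(f2 \<circ> inv_into U \<phi> has_derivative D2) (at (\<phi> p))"
    unfolding differentiable_def by blast
  then have "((\<lambda>x. of_real ((f1 \<circ> inv_into U \<phi>) x) + \<i> * of_real ((f2 \<circ> inv_into U \<phi>) x)) has_derivative
      (\<lambda>h. of_real (D1 h) + \<i> * of_real (D2 h))) (at (\<phi> p))"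
    by (intro has_derivative_add has_derivative_mult_right has_derivative_of_real)
  moreover have "(\<lambda>q. Complex (f1 q) (f2 q)) \<circ> inv_into U \<phi> =
      (\<lambda>x. of_real ((f1 \<circ> inv_into U \<phi>) x) + \<i> * of_real ((f2 \<circ> inv_into U \<phi>) x))"
    by (simp add: fun_eq_iff Complex_eq)
  ultimately show "(\<lambda>q. Complex (f1 q) (f2 q)) \<circ> inv_into U \<phi> differentiable at (\<phi> p)"
    unfolding differentiable_def by auto
qed

lemma differentiable_at_point_compose:
  fixes A :: "('a::t2_space, 'e::euclidean_space) chart set"
  assumes A: "topological_atlas A" and B: "topological_atlas B"
    and F: "smooth_map_on A B N F" "open N" "p \<in> N" and k: "differentiable_at_point B (F p) k"
  shows "differentiable_at_point A p (\<lambda>q. k (F q))"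
  unfolding differentiable_at_point_def
proof safe
  fix U \<phi> assume U: "(U, \<phi>) \<in> A" "p \<in> U"
  obtain V \<psi> where V: "(V, \<psi>) \<in> B" "F p \<in> V" by (rule chart_around[OF B])
  have inj: "inj_on \<phi> U" "inj_on \<psi> V" using A B U V by (auto intro: chart_inj)
  have "open (N \<inter> F -` V)"
    using smooth_map_on_continuous[OF F(1)] F(2) chart_open[OF B V(1)] by (rule continuous_open_preimage)
  then have oX: "open (\<phi> ` ((N \<inter> F -` V) \<inter> U))" by (rule chart_open_map[OF A U(1)])
  have "smooth_on (\<phi> ` ((N \<inter> F -` V) \<inter> U)) (\<psi> \<circ> F \<circ> inv_into U \<phi>)"
    by (rule smooth_on_subset[OF smooth_map_onD[OF F(1) U(1) V(1)]]) auto
  then have 1: "\<psi> \<circ> F \<circ> inv_into U \<phi> differentiable (at (\<phi> p))"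
    by (rule smooth_on_differentiable) (use F(3) U V in auto)
  have 2: "k \<circ> inv_into V \<psi> differentiable (at ((\<psi> \<circ> F \<circ> inv_into U \<phi>) (\<phi> p)))"
    using differentiable_at_pointD[OF k V] U(2) inj by (simp add: inv_into_f_f)
  obtain D where D: "((k \<circ> inv_into V \<psi>) \<circ> (\<psi> \<circ> F \<circ> inv_into U \<phi>) has_derivative D) (at (\<phi> p))"
    using differentiable_chain_at[OF 1 2] unfolding differentiable_def by blast
  have "(((\<lambda>q. k (F q)) \<circ> inv_into U \<phi>) has_derivative D) (at (\<phi> p))"
    by (rule has_derivative_transform_within_open[OF D oX])
      (use F(3) U V inj in \<open>auto simp: inv_into_f_f\<close>)
  then show "(\<lambda>q. k (F q)) \<circ> inv_into U \<phi> differentiable at (\<phi> p)"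
    unfolding differentiable_def by blast
qed

lemma velocity_eq:
  "smooth_near A (c 0) f \<Longrightarrow> velocity A c f = deriv (\<lambda>t. f (c t)) 0"
  by (simp add: velocity_def)

lemma velocity_has_derivative:
  assumes A: "topological_atlas A" and c: "smooth_curve_at A p c" and f: "smooth_near A p f"
  shows "((\<lambda>t. f (c t)) has_real_derivative velocity A c f) (at 0)"
proof -
  have "(\<lambda>t. f (c t)) differentiable (at 0)"
    by (rule differentiable_at_point_curve_differentiable[OF A smooth_near_differentiable[OF f] c])
  moreover have "c 0 = p" using c by (simp add: smooth_curve_at_def)
  ultimately show ?thesis
    using f by (simp add: velocity_eq DERIV_deriv_iff_real_differentiable)
qed

lemma differential_velocity:
  assumes A: "topological_atlas A" and B: "topological_atlas B"
    and c: "smooth_curve_at A p c" and F: "smooth_map_on A B N F" "open N" "p \<in> N"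
  shows "differential B p F (velocity A c) = velocity B (\<lambda>t. F (c t))"
proof
  fix f
  have c0: "c 0 = p" using c by (simp add: smooth_curve_at_def)
  show "differential B p F (velocity A c) f = velocity B (\<lambda>t. F (c t)) f"
    using smooth_near_compose[OF A B F, of f]
    by (auto simp: differential_def velocity_def c0)
qed

text \<open>By the chain rule, a curve that is stationary in one chart is stationary for all smooth
  functions. So tangent vectors are determined by their coordinates in a chart.\<close>

lemma velocity_zeroI:
  fixes A :: "('a::{t2_space,second_countable_topology}, 'e::euclidean_space) chart set"
  assumes A: "topological_atlas A" and U: "(U, \<phi>) \<in> A" "p \<in> U"
    and c: "smooth_curve_at A p c" and zero: "((\<lambda>t. \<phi> (c t)) has_vector_derivative 0) (at 0)"
  shows "velocity A c = (\<lambda>f. 0)"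
proof
  fix f
  have c0: "c 0 = p" using c by (simp add: smooth_curve_at_def)
  show "velocity A c f = 0"
  proof (cases "smooth_near A p f")
    case True
    obtain v where v: "((\<lambda>t. \<phi> (c t)) has_vector_derivative v) (at 0)"
      and D: "((\<lambda>t. f (c t)) has_vector_derivative frechet_derivative (f \<circ> inv_into U \<phi>) (at (\<phi> p)) v) (at 0)"
      by (rule differentiable_at_point_curve[OF A smooth_near_differentiable[OF True] c U])
    have "v = 0" using v zero by (rule vector_derivative_unique_at)
    moreover have "linear (frechet_derivative (f \<circ> inv_into U \<phi>) (at (\<phi> p)))"
      by (intro linear_frechet_derivative differentiable_at_pointD[OF smooth_near_differentiable[OF True] U])
    ultimately have "((\<lambda>t. f (c t)) has_real_derivative 0) (at 0)"
      using D by (simp add: linear_0 has_real_derivative_iff_has_vector_derivative)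
    then show ?thesis
      using True by (simp add: velocity_eq c0 DERIV_imp_deriv)
  qed (simp add: velocity_def c0)
qed

section \<open>The action of a Lie skew brace on its tangent space\<close>

text \<open>The vector space \<open>'g\<close> is identified with the tangent space at the identity by \<open>\<Phi>\<close>.\<close>

locale lie_skew_brace_tangent =
  fixes A :: "('a::{t2_space,second_countable_topology}, 'e::euclidean_space) chart set"
    and G H :: "'a monoid" and \<Phi> :: "'g::real_vector \<Rightarrow> 'a tangent"
  assumes brace: "lie_skew_brace A G H"
    and \<Phi>_bij: "bij_betw \<Phi> UNIV (tangent_space A \<one>\<^bsub>G\<^esub>)"
    and \<Phi>_add: "\<Phi> (x + y) f = \<Phi> x f + \<Phi> y f"
    and \<Phi>_scale: "\<Phi> (r *\<^sub>R x) f = r * \<Phi> x f"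
begin

sublocale dot: group G
  using brace by (simp add: lie_skew_brace_def lie_group_def)

sublocale circ: group H
  using brace by (simp add: lie_skew_brace_def lie_group_def)

lemma carrier_dot [simp]: "x \<in> carrier G" and carrier_circ [simp]: "x \<in> carrier H"
  using brace by (simp_all add: lie_skew_brace_def lie_group_def)

lemma one_circ [simp]: "\<one>\<^bsub>H\<^esub> = \<one>\<^bsub>G\<^esub>"
  using brace by (rule lie_skew_brace_one)

lemma circ_one [simp]: "g \<otimes>\<^bsub>H\<^esub> \<one>\<^bsub>G\<^esub> = g" "\<one>\<^bsub>G\<^esub> \<otimes>\<^bsub>H\<^esub> g = g"
  unfolding one_circ[symmetric] by simp_all

lemma atlas: "smooth_atlas A"
  using brace by (simp add: lie_skew_brace_def lie_group_def)

lemma top_atlas: "topological_atlas A"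
  using atlas by (rule smooth_atlas_topological)

lemma prod_top_atlas: "topological_atlas (prod_atlas A A)"
  using top_atlas top_atlas by (rule topological_atlas_prod)

lemma brace_eq: "g \<otimes>\<^bsub>H\<^esub> (h \<otimes>\<^bsub>G\<^esub> k) = (g \<otimes>\<^bsub>H\<^esub> h) \<otimes>\<^bsub>G\<^esub> inv\<^bsub>G\<^esub> g \<otimes>\<^bsub>G\<^esub> (g \<otimes>\<^bsub>H\<^esub> k)"
  using brace unfolding lie_skew_brace_def by blast

abbreviation lam :: "'a \<Rightarrow> 'a \<Rightarrow> 'a" where "lam \<equiv> brace_lambda G H"

lemma lam_eq: "g \<otimes>\<^bsub>G\<^esub> lam g h = g \<otimes>\<^bsub>H\<^esub> h"
  by (simp add: brace_lambda_def flip: dot.m_assoc)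

lemma lam_one [simp]: "lam g \<one>\<^bsub>G\<^esub> = \<one>\<^bsub>G\<^esub>" and lam_one_left [simp]: "lam \<one>\<^bsub>G\<^esub> h = h"
  by (simp_all add: brace_lambda_def)

lemma lam_mult: "lam g (h \<otimes>\<^bsub>G\<^esub> k) = lam g h \<otimes>\<^bsub>G\<^esub> lam g k"
  by (simp add: brace_lambda_def brace_eq dot.m_assoc)

text \<open>Evaluate \<open>g \<circ> (h \<cdot> \<lambda>\<^sub>h(k)) = g \<circ> h \<circ> k\<close> in two ways and cancel \<open>g \<circ> h\<close>.\<close>

lemma lam_circ: "lam (g \<otimes>\<^bsub>H\<^esub> h) k = lam g (lam h k)"
proof -
  have "(g \<otimes>\<^bsub>H\<^esub> h) \<otimes>\<^bsub>G\<^esub> lam (g \<otimes>\<^bsub>H\<^esub> h) k = g \<otimes>\<^bsub>H\<^esub> (h \<otimes>\<^bsub>G\<^esub> lam h k)"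
    by (simp add: lam_eq circ.m_assoc)
  also have "\<dots> = g \<otimes>\<^bsub>G\<^esub> lam g (h \<otimes>\<^bsub>G\<^esub> lam h k)" by (simp add: lam_eq)
  also have "\<dots> = (g \<otimes>\<^bsub>H\<^esub> h) \<otimes>\<^bsub>G\<^esub> lam g (lam h k)" 
    unfolding lam_mult by (simp add: lam_eq flip: dot.m_assoc)
  finally show ?thesis by simp
qed

lemma smooth_dot: "smooth_map_on (prod_atlas A A) A UNIV (\<lambda>(g, h). g \<otimes>\<^bsub>G\<^esub> h)"
  and smooth_circ: "smooth_map_on (prod_atlas A A) A UNIV (\<lambda>(g, h). g \<otimes>\<^bsub>H\<^esub> h)"
  and smooth_inv: "smooth_map_on A A UNIV (\<lambda>g. inv\<^bsub>G\<^esub> g)"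
  using brace by (simp_all add: lie_skew_brace_def lie_group_def)

lemma smooth_pairing:
  assumes B: "topological_atlas B" and K: "smooth_map_on (prod_atlas A A) A UNIV (\<lambda>(g, h). K g h)"
    and "smooth_map_on B A N F" "smooth_map_on B A N F'" "open N"
  shows "smooth_map_on B A N (\<lambda>p. K (F p) (F' p))"
  using smooth_map_on_compose[OF B prod_top_atlas top_atlas
      smooth_map_on_Pair[OF B top_atlas top_atlas assms(3,4,5)] K assms(5) open_UNIV subset_UNIV]
  by simp

lemma smooth_dot_left: "smooth_map_on A A UNIV (\<lambda>h. g \<otimes>\<^bsub>G\<^esub> h)"
  and smooth_circ_left: "smooth_map_on A A UNIV (\<lambda>h. g \<otimes>\<^bsub>H\<^esub> h)"
  and smooth_circ_right: "smooth_map_on A A UNIV (\<lambda>h. h \<otimes>\<^bsub>H\<^esub> g)"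
  by (rule smooth_pairing[OF top_atlas] smooth_dot smooth_circ smooth_map_on_const
      smooth_map_on_ident[OF atlas] open_UNIV)+

lemma smooth_lam_pair: "smooth_map_on (prod_atlas A A) A UNIV (\<lambda>(g, h). lam g h)"
proof -
  have fst: "smooth_map_on (prod_atlas A A) A UNIV fst" 
    by (rule smooth_map_on_fst[OF atlas top_atlas])
  have "smooth_map_on (prod_atlas A A) A UNIV (\<lambda>p. inv\<^bsub>G\<^esub> (fst p))"
    by (rule smooth_map_on_compose[OF prod_top_atlas top_atlas top_atlas fst smooth_inv open_UNIV open_UNIV subset_UNIV])
  from smooth_pairing[OF prod_top_atlas smooth_dot this smooth_circ open_UNIV]
  show ?thesis by (simp add: brace_lambda_def case_prod_unfold)
qed

lemma smooth_lam: "smooth_map_on A A UNIV (lam g)"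
  by (rule smooth_pairing[OF top_atlas smooth_lam_pair smooth_map_on_const smooth_map_on_ident[OF atlas] open_UNIV])

abbreviation curve :: "'a \<Rightarrow> (real \<Rightarrow> 'a) \<Rightarrow> bool" where "curve \<equiv> smooth_curve_at A"

lemma curve_compose: "curve p c \<Longrightarrow> smooth_map_on A A UNIV F \<Longrightarrow> curve (F p) (\<lambda>t. F (c t))"
  by (rule smooth_curve_at_compose[OF top_atlas top_atlas _ _ open_UNIV UNIV_I])

lemma \<Phi>_eq_iff: "\<Phi> x = \<Phi> y \<longleftrightarrow> x = y"
  using \<Phi>_bij by (auto simp: bij_betw_def inj_eq)

lemma obtain_curve:
  obtains c where "curve \<one>\<^bsub>G\<^esub> c" "velocity A c = \<Phi> x"
proof -
  have "\<Phi> x \<in> tangent_space A \<one>\<^bsub>G\<^esub>" using \<Phi>_bij by (auto simp: bij_betw_def)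
  then obtain c where "\<Phi> x = velocity A c" "curve \<one>\<^bsub>G\<^esub> c"
    unfolding tangent_space_def by blast
  then show ?thesis by (intro that) auto
qed

lemma obtain_velocity:
  assumes "curve \<one>\<^bsub>G\<^esub> c"
  obtains x where "\<Phi> x = velocity A c"
proof -
  have "velocity A c \<in> range \<Phi>" using assms \<Phi>_bij by (auto simp: bij_betw_def tangent_space_def)
  then show ?thesis using that by fastforce
qed

text \<open>The differential of \<open>lam g\<close> at the identity, transported to \<open>'g\<close>.\<close>

definition dlam :: "'a \<Rightarrow> 'g \<Rightarrow> 'g" where
  "dlam g x = inv_into UNIV \<Phi> (differential A \<one>\<^bsub>G\<^esub> (lam g) (\<Phi> x))"

lemma differential_lam:
  "curve \<one>\<^bsub>G\<^esub> c \<Longrightarrow> differential A \<one>\<^bsub>G\<^esub> (lam g) (velocity A c) = velocity A (\<lambda>t. lam g (c t))"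
  by (rule differential_velocity[OF top_atlas top_atlas _ smooth_lam open_UNIV UNIV_I])

lemma \<Phi>_dlam: "\<Phi> (dlam g x) = differential A \<one>\<^bsub>G\<^esub> (lam g) (\<Phi> x)"
proof -
  obtain c where c: "curve \<one>\<^bsub>G\<^esub> c" "velocity A c = \<Phi> x" by (rule obtain_curve)
  have "curve \<one>\<^bsub>G\<^esub> (\<lambda>t. lam g (c t))" using curve_compose[OF c(1) smooth_lam, of g] by simp
  then have "differential A \<one>\<^bsub>G\<^esub> (lam g) (\<Phi> x) \<in> tangent_space A \<one>\<^bsub>G\<^esub>"
    using differential_lam[OF c(1), of g] unfolding c(2) tangent_space_def by blast
  then show ?thesis
    using \<Phi>_bij unfolding dlam_def by (auto simp: bij_betw_def intro: f_inv_into_f)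
qed

lemma \<Phi>_dlam_velocity:
  "curve \<one>\<^bsub>G\<^esub> c \<Longrightarrow> velocity A c = \<Phi> x \<Longrightarrow> \<Phi> (dlam g x) = velocity A (\<lambda>t. lam g (c t))"
  using differential_lam[of c g] by (simp add: \<Phi>_dlam)

lemma dlam_one [simp]: "dlam \<one>\<^bsub>G\<^esub> x = x"
proof -
  obtain c where c: "curve \<one>\<^bsub>G\<^esub> c" "velocity A c = \<Phi> x" by (rule obtain_curve)
  show ?thesis using \<Phi>_dlam_velocity[OF c, of "\<one>\<^bsub>G\<^esub>"] c(2) by (simp add: \<Phi>_eq_iff)
qed

lemma dlam_circ: "dlam (g \<otimes>\<^bsub>H\<^esub> h) x = dlam g (dlam h x)"
proof -
  obtain c where c: "curve \<one>\<^bsub>G\<^esub> c" "velocity A c = \<Phi> x" by (rule obtain_curve)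
  have "curve \<one>\<^bsub>G\<^esub> (\<lambda>t. lam h (c t))" using curve_compose[OF c(1) smooth_lam, of h] by simp
  from \<Phi>_dlam_velocity[OF this \<Phi>_dlam_velocity[OF c, symmetric], of g]
  have "\<Phi> (dlam g (dlam h x)) = \<Phi> (dlam (g \<otimes>\<^bsub>H\<^esub> h) x)"
    using \<Phi>_dlam_velocity[OF c, of "g \<otimes>\<^bsub>H\<^esub> h"] by (simp add: lam_circ)
  then show ?thesis by (simp add: \<Phi>_eq_iff)
qed

text \<open>If \<open>c\<close> is a curve with velocity \<open>y\<close>, the function in question is the derivative at \<open>s = 0\<close> of
  the smooth function \<open>f (lam g (c s))\<close> of \<open>(g, s)\<close>. Velocities are \<open>0\<close> on functions that are not
  smooth, so this is what gives the definition of \<open>brace_triangle\<close> its meaning.\<close>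

lemma smooth_near_dlam:
  assumes f: "smooth_near A \<one>\<^bsub>G\<^esub> f"
  shows "smooth_near A p (\<lambda>g. \<Phi> (dlam g y) f)"
proof -
  obtain c where c: "curve \<one>\<^bsub>G\<^esub> c" "velocity A c = \<Phi> y" by (rule obtain_curve)
  then obtain I where I: "open I" "0 \<in> I" "smooth_map_on standard_atlas A I c" and c0: "c 0 = \<one>\<^bsub>G\<^esub>"
    by (auto simp: smooth_curve_at_iff)
  let ?B = "prod_atlas A (standard_atlas :: (real, real) chart set)"
  have B: "topological_atlas ?B" by (rule topological_atlas_prod[OF top_atlas topological_atlas_standard])
  have N: "open (UNIV \<times> I :: ('a \<times> real) set)" using I(1) by (simp add: open_Times)
  have 1: "smooth_map_on ?B A (UNIV \<times> I) fst"
    by (rule smooth_map_on_fst[OF atlas topological_atlas_standard])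
  have snd: "smooth_map_on ?B standard_atlas (UNIV \<times> I) snd"
    by (rule smooth_map_on_snd[OF top_atlas smooth_atlas_standard])
  have 2: "smooth_map_on ?B A (UNIV \<times> I) (\<lambda>z. c (snd z))"
    by (rule smooth_map_on_compose[OF B topological_atlas_standard top_atlas snd I(3) N I(1)]) auto
  have "smooth_map_on ?B A (UNIV \<times> I) (\<lambda>z. lam (fst z) (c (snd z)))"
    by (rule smooth_pairing[OF B smooth_lam_pair 1 2 N])
  from smooth_near_compose[OF B top_atlas this N, of "(p, 0)" f] f I(2)
  have "smooth_near ?B (p, 0) (\<lambda>z. f (lam (fst z) (c (snd z))))"
    by (simp add: c0)
  from smooth_near_partial_derivative[OF top_atlas this]
  have "smooth_near A p (\<lambda>g. deriv (\<lambda>s. f (lam g (c s))) 0)" by simp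
  moreover have "\<Phi> (dlam g y) f = deriv (\<lambda>s. f (lam g (c s))) 0" for g
    using f by (simp add: \<Phi>_dlam_velocity[OF c] velocity_eq c0)
  ultimately show ?thesis by simp
qed

lemma brace_triangle_eq:
  assumes f: "smooth_near A \<one>\<^bsub>G\<^esub> f"
  shows "brace_triangle A G H (\<Phi> x) (\<Phi> y) f = \<Phi> x (\<lambda>g. \<Phi> (dlam g y) f)"
  using f by (simp add: brace_triangle_def \<Phi>_dlam)

text \<open>Every linear functional on the tangent space is the differential of a smooth function,
  which can be chosen linear in a chart: the coordinate map \<open>\<kappa>\<close> of the tangent space is injective, so
  \<open>l\<close> factors through it.\<close>

lemma functional_representation:
  fixes l :: "'g \<Rightarrow> real"
  assumes l: "linear l"
  obtains f where "smooth_near A \<one>\<^bsub>G\<^esub> f" "\<And>x. l x = \<Phi> x f"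
proof -
  obtain U \<phi> where U: "(U, \<phi>) \<in> A" "\<one>\<^bsub>G\<^esub> \<in> U" by (rule chart_around[OF top_atlas])
  have near: "smooth_near A \<one>\<^bsub>G\<^esub> (\<lambda>q. L (\<phi> q))" if "linear L" for L :: "'e \<Rightarrow> real"
  proof -
    have L: "smooth_map_on standard_atlas standard_atlas UNIV L"
      using that by (simp add: smooth_map_on_standard smooth_on_bounded_linear linear_conv_bounded_linear)
    have "smooth_map_on A standard_atlas U (\<lambda>q. L (\<phi> q))"
      by (rule smooth_map_on_compose[OF top_atlas topological_atlas_standard topological_atlas_standard
            smooth_map_on_chart[OF atlas U(1)] L chart_open[OF top_atlas U(1)] open_UNIV subset_UNIV])
    then show ?thesis
      using U chart_open[OF top_atlas U(1)] unfolding smooth_near_def by blast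
  qed
  have coord: "linear (\<lambda>v::'e. v \<bullet> b)" for b
    by (simp add: linear_iff inner_add_left)
  define \<kappa> where "\<kappa> x = (\<Sum>b\<in>Basis. \<Phi> x (\<lambda>q. \<phi> q \<bullet> b) *\<^sub>R b)" for x
  have \<kappa>: "((\<lambda>t. \<phi> (c t)) has_vector_derivative \<kappa> x) (at 0)"
    if c: "curve \<one>\<^bsub>G\<^esub> c" "velocity A c = \<Phi> x" for c x
  proof -
    have "((\<lambda>t. \<phi> (c t) \<bullet> b) has_vector_derivative \<Phi> x (\<lambda>q. \<phi> q \<bullet> b)) (at 0)" for b
      using velocity_has_derivative[OF top_atlas c(1) near[OF coord[of b]]]
      by (simp add: c(2) has_real_derivative_iff_has_vector_derivative)
    then have "((\<lambda>t. \<Sum>b\<in>Basis. (\<phi> (c t) \<bullet> b) *\<^sub>R b) has_vector_derivative \<kappa> x) (at 0)"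
      unfolding \<kappa>_def
      by (intro has_vector_derivative_sum bounded_linear.has_vector_derivative[OF bounded_linear_scaleR_left])
    then show ?thesis by (simp add: euclidean_representation)
  qed
  have "linear \<kappa>"
    unfolding \<kappa>_def
    by (rule linearI) (simp_all add: \<Phi>_add \<Phi>_scale scaleR_left_distrib sum.distrib scaleR_sum_right)
  moreover have "inj \<kappa>"
    unfolding linear_injective_0[OF \<open>linear \<kappa>\<close>]
  proof (intro allI impI)
    fix x assume "\<kappa> x = 0"
    obtain c where c: "curve \<one>\<^bsub>G\<^esub> c" "velocity A c = \<Phi> x" by (rule obtain_curve)
    have "\<Phi> x = (\<lambda>f. 0)"
      using velocity_zeroI[OF top_atlas U c(1)] \<kappa>[OF c] by (simp add: \<open>\<kappa> x = 0\<close> c(2))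
    also have "(\<lambda>f. 0) = \<Phi> 0" using \<Phi>_scale[of 0 0] by (simp add: fun_eq_iff)
    finally show "x = 0" by (simp add: \<Phi>_eq_iff)
  qed
  ultimately obtain \<rho> where \<rho>: "linear \<rho>" "\<rho> \<circ> \<kappa> = id"
    using linear_injective_left_inverse by blast
  have lin: "linear (\<lambda>v. l (\<rho> v))"
    using linear_compose[OF \<rho>(1) l] by (simp add: comp_def)
  show ?thesis
  proof (rule that)
    show "smooth_near A \<one>\<^bsub>G\<^esub> (\<lambda>q. l (\<rho> (\<phi> q)))" by (rule near[OF lin])
    fix x
    obtain c where c: "curve \<one>\<^bsub>G\<^esub> c" "velocity A c = \<Phi> x" by (rule obtain_curve)
    have "((\<lambda>t. l (\<rho> (\<phi> (c t)))) has_vector_derivative l (\<rho> (\<kappa> x))) (at 0)"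
      using bounded_linear.has_vector_derivative[OF lin[unfolded linear_conv_bounded_linear] \<kappa>[OF c]] .
    moreover have "((\<lambda>t. l (\<rho> (\<phi> (c t)))) has_vector_derivative \<Phi> x (\<lambda>q. l (\<rho> (\<phi> q)))) (at 0)"
      using velocity_has_derivative[OF top_atlas c(1) near[OF lin]]
      by (simp add: c(2) has_real_derivative_iff_has_vector_derivative)
    ultimately have "l (\<rho> (\<kappa> x)) = \<Phi> x (\<lambda>q. l (\<rho> (\<phi> q)))"
      by (rule vector_derivative_unique_at)
    moreover have "\<rho> (\<kappa> x) = x" using \<rho>(2) by (simp add: fun_eq_iff)
    ultimately show "l x = \<Phi> x (\<lambda>q. l (\<rho> (\<phi> q)))" by simp
  qed
qed

end

section \<open>Subrings of the complex numbers that contain a curve\<close>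

text \<open>If \<open>w \<in> W\<close> is not real, then \<open>h z = f (Re z) + w * f (Im z)\<close> maps into \<open>W\<close> and has at \<open>0\<close> the
  derivative \<open>z \<mapsto> a * (Re z + w * Im z)\<close>, which is invertible if \<open>a \<noteq> 0\<close>. So \<open>W\<close> is a neighbourhood of
  \<open>0\<close>. If all of \<open>W\<close> is real, the curve \<open>f\<close> fills an interval that starts at \<open>0\<close>. Either way \<open>W\<close>
  contains \<open>1 / n\<close> or \<open>-1 / n\<close> for some \<open>n > 0\<close>, and then \<open>-1\<close>.\<close>

lemma subring_without_minus_one_no_curve:
  fixes W :: "complex set" and f :: "real \<Rightarrow> complex"
  assumes add: "\<And>v w. v \<in> W \<Longrightarrow> w \<in> W \<Longrightarrow> v + w \<in> W" and neg: "\<And>w. w \<in> W \<Longrightarrow> - w \<in> W"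
    and mult: "\<And>v w. v \<in> W \<Longrightarrow> w \<in> W \<Longrightarrow> v * w \<in> W" and minus_one: "-1 \<notin> W"
    and f: "open I" "0 \<in> I" "connected I" "continuous_on I f" "f ` I \<subseteq> W" "f 0 = 0"
    and deriv: "(f has_vector_derivative a) (at 0)"
  shows "a = 0"
proof (rule ccontr)
  assume "a \<noteq> 0"
  have "0 \<in> W" using f by force
  then have nat: "of_nat n * w \<in> W" if "w \<in> W" for n w
    by (induction n) (use that add in \<open>auto simp: distrib_right\<close>)
  show False
  proof (cases "\<exists>w\<in>W. Im w \<noteq> 0")
    case True
    then obtain w where w: "w \<in> W" "Im w \<noteq> 0" by blast
    define h where "h z = f (Re z) + w * f (Im z)" for z
    define S where "S = Re -` I \<inter> Im -` I"
    \<comment> \<open>inverse of the derivative: the coordinates of \<open>v / a\<close> in the real basis \<open>1, w\<close>\<close>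
    define D' where "D' v = (let y = Im (v / a) / Im w in Complex (Re (v / a) - Re w * y) y)" for v
    have "open S"
      unfolding S_def using f(1) by (intro open_Int open_vimage continuous_intros)
    have "0 \<in> interior (h ` S)"
    proof -
      have D: "(h has_derivative (\<lambda>z. Re z *\<^sub>R a + w * (Im z *\<^sub>R a))) (at 0)"
        unfolding h_def
      proof (intro has_derivative_add has_derivative_mult_right)
        have "(f has_derivative (\<lambda>x. x *\<^sub>R a)) (at (Re 0))" "(f has_derivative (\<lambda>x. x *\<^sub>R a)) (at (Im 0))"
          using deriv by (simp_all add: has_vector_derivative_def)
        from has_derivative_compose[OF has_derivative_Re[OF has_derivative_ident] this(1)]
          has_derivative_compose[OF has_derivative_Im[OF has_derivative_ident] this(2)]
        show "((\<lambda>z. f (Re z)) has_derivative (\<lambda>z. Re z *\<^sub>R a)) (at 0)"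
          "((\<lambda>z. f (Im z)) has_derivative (\<lambda>z. Im z *\<^sub>R a)) (at 0)" .
      qed
      have "continuous_on S h"
        unfolding h_def S_def
        by (intro continuous_on_add continuous_on_mult continuous_on_const
            continuous_on_compose2[OF f(4)] continuous_on_Re continuous_on_Im continuous_on_id) auto
      moreover have "linear D'"
      proof -
        have "(r *\<^sub>R b) / a = r *\<^sub>R (b / a)" for r b by (simp add: scaleR_conv_of_real)
        then show ?thesis
          by (intro linearI) (auto simp: D'_def Let_def complex_eq_iff add_divide_distrib algebra_simps)
      qed
      moreover have "(\<lambda>z. Re z *\<^sub>R a + w * (Im z *\<^sub>R a)) \<circ> D' = id"
      proof
        fix v
        define y where "y = Im (v / a) / Im w"
        have "complex_of_real (Re (v / a) - Re w * y) + w * y = v / a"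
          using w(2) by (simp add: complex_eq_iff y_def)
        then have "v = (complex_of_real (Re (v / a) - Re w * y) + w * y) * a"
          using \<open>a \<noteq> 0\<close> by simp
        then show "((\<lambda>z. Re z *\<^sub>R a + w * (Im z *\<^sub>R a)) \<circ> D') v = id v"
          by (simp add: D'_def Let_def y_def[symmetric] scaleR_conv_of_real distrib_right mult.assoc)
      qed
      moreover have "0 \<in> S" "0 \<in> interior S"
        unfolding interior_open[OF \<open>open S\<close>] using f(2) by (simp_all add: S_def)
      ultimately have "h 0 \<in> interior (h ` S)"
        by (intro sussmann_open_mapping[OF \<open>open S\<close> _ _ D])
          (auto simp: linear_conv_bounded_linear)
      then show ?thesis using f(6) by (simp add: h_def)
    qed
    moreover have "h ` S \<subseteq> W"
      using f(5) w(1) by (auto simp: h_def S_def intro!: add mult)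
    ultimately obtain r where r: "r > 0" "ball 0 r \<subseteq> W"
      unfolding mem_interior by blast
    obtain n where n: "n > 0" "inverse (real n) < r" using ex_inverse_of_nat_less[OF r(1)] by blast
    then have "- (1 / of_nat n) \<in> W"
      using r(2) by (intro subsetD[OF r(2)]) (simp add: norm_divide inverse_eq_divide)
    from nat[OF this, of n] n(1) minus_one show False by simp
  next
    case False
    have "\<exists>t\<in>I. f t \<noteq> 0"
    proof (rule ccontr)
      assume "\<not> ?thesis"
      then have "((\<lambda>t. 0) has_vector_derivative a) (at 0)"
        by (intro has_vector_derivative_transform_within_open[OF deriv f(1,2)]) auto
      with \<open>a \<noteq> 0\<close> show False using vector_derivative_unique_at has_vector_derivative_const by blast
    qed
    then obtain t where t: "t \<in> I" "f t \<noteq> 0" by blast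
    define r where "r = Re (f t)"
    have real: "f s = of_real (Re (f s))" if "s \<in> I" for s
      using False f(5) that by (auto simp: complex_eq_iff)
    have "r \<noteq> 0" using t real[of t] by (auto simp: r_def)
    obtain n where n: "n > 0" "inverse (real n) < \<bar>r\<bar>"
      using ex_inverse_of_nat_less[of "\<bar>r\<bar>"] \<open>r \<noteq> 0\<close> by auto
    have "connected ((\<lambda>s. Re (f s)) ` I)"
      using f(3,4) by (intro connected_continuous_image continuous_on_Re)
    moreover have "0 \<in> (\<lambda>s. Re (f s)) ` I" "r \<in> (\<lambda>s. Re (f s)) ` I"
      using f(2,6) t(1) by (auto simp: r_def intro!: image_eqI[of _ _ 0])
    ultimately have "sgn r * inverse (real n) \<in> (\<lambda>s. Re (f s)) ` I"
      unfolding connected_iff_interval using n \<open>r \<noteq> 0\<close>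
      by (cases "r > 0") (auto simp: sgn_if)
    then obtain s where s: "s \<in> I" "Re (f s) = sgn r * inverse (real n)" by force
    then have "of_real (sgn r * inverse (real n)) \<in> W"
      using f(5) real[of s] by force
    moreover have "of_nat n * of_real (sgn r * inverse (real n)) = (of_real (sgn r) :: complex)"
      using n(1) by (simp add: field_simps)
    ultimately have "of_real (sgn r) \<in> W" using nat by metis
    then show False using neg[of "of_real (sgn r)"] minus_one \<open>r \<noteq> 0\<close> by (auto simp: sgn_if split: if_splits)
  qed
qed

section \<open>Characters of the post-Lie product of a Lie skew brace\<close>

text \<open>These assumptions force \<open>\<xi> = 0\<close>, by lemma \<open>character_trivial\<close> below.\<close>

locale lie_skew_brace_character = lie_skew_brace_tangent +
  fixes tri :: "'c \<Rightarrow> 'c \<Rightarrow> 'c" and \<xi> :: "'c \<Rightarrow> complex"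
  assumes connected: "connected (UNIV :: 'a set)"
    and tri: "\<Phi> (tri x y) = brace_triangle A G H (\<Phi> x) (\<Phi> y)"
    and linear_\<xi>: "linear \<xi>"
    and \<xi>_tri: "\<xi> (tri x y) = \<xi> x * \<xi> y"
begin

text \<open>Write \<open>\<xi>\<close> as the differential of a pair of real functions \<open>f1, f2\<close>. Then the definition of
  \<open>brace_triangle\<close>, evaluated at them, is a derivative along \<open>c\<close>.\<close>

lemma
  shows differentiable_dlam: "differentiable_at_point A p (\<lambda>g. \<xi> (dlam g y))"
    and derivative_dlam: "curve \<one>\<^bsub>G\<^esub> c \<Longrightarrow> velocity A c = \<Phi> x \<Longrightarrow>
      ((\<lambda>t. \<xi> (dlam (c t) y)) has_vector_derivative \<xi> x * \<xi> y) (at 0)"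
proof -
  have "linear (\<lambda>x. Re (\<xi> x))" "linear (\<lambda>x. Im (\<xi> x))"
    using linear_\<xi> by (simp_all add: linear_iff)
  then obtain f1 f2 where f: "smooth_near A \<one>\<^bsub>G\<^esub> f1" "smooth_near A \<one>\<^bsub>G\<^esub> f2"
    and eq: "\<And>x. Re (\<xi> x) = \<Phi> x f1" "\<And>x. Im (\<xi> x) = \<Phi> x f2"
    using functional_representation by metis
  have \<xi>_eq: "\<xi> x = Complex (\<Phi> x f1) (\<Phi> x f2)" for x
    by (simp add: complex_eq_iff eq)
  show "differentiable_at_point A p (\<lambda>g. \<xi> (dlam g y))"
    unfolding \<xi>_eq
    by (intro differentiable_at_point_Complex smooth_near_differentiable smooth_near_dlam f)
  assume c: "curve \<one>\<^bsub>G\<^esub> c" "velocity A c = \<Phi> x"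
  have "((\<lambda>t. \<Phi> (dlam (c t) y) f) has_real_derivative \<Phi> (tri x y) f) (at 0)"
    if "smooth_near A \<one>\<^bsub>G\<^esub> f" for f
    using velocity_has_derivative[OF top_atlas c(1) smooth_near_dlam[OF that]]
    by (simp add: c(2) tri brace_triangle_eq[OF that])
  from this[OF f(1)] this[OF f(2)]
  have "((\<lambda>t. \<xi> (dlam (c t) y)) has_vector_derivative \<xi> (tri x y)) (at 0)"
    unfolding \<xi>_eq by (simp add: has_vector_derivative_complex_iff has_real_derivative_iff_has_vector_derivative)
  then show "((\<lambda>t. \<xi> (dlam (c t) y)) has_vector_derivative \<xi> x * \<xi> y) (at 0)"
    by (simp add: \<xi>_tri)
qed

text \<open>Right translations of the second group move the derivative at \<open>p\<close> to the identity. The factor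
  \<open>z\<close> is the value of \<open>\<xi>\<close> at the translated velocity; what matters is that it does not depend on
  \<open>y\<close>.\<close>

lemma derivative_dlam_at:
  assumes c: "curve p c"
  shows "\<exists>z. \<forall>y. ((\<lambda>t. \<xi> (dlam (c t) y)) has_vector_derivative z * \<xi> (dlam p y)) (at 0)"
proof -
  have "curve (p \<otimes>\<^bsub>H\<^esub> inv\<^bsub>H\<^esub> p) (\<lambda>t. c t \<otimes>\<^bsub>H\<^esub> inv\<^bsub>H\<^esub> p)"
    using c smooth_circ_right by (rule curve_compose)
  then have c': "curve \<one>\<^bsub>G\<^esub> (\<lambda>t. c t \<otimes>\<^bsub>H\<^esub> inv\<^bsub>H\<^esub> p)" by simp
  then obtain x where x: "\<Phi> x = velocity A (\<lambda>t. c t \<otimes>\<^bsub>H\<^esub> inv\<^bsub>H\<^esub> p)" by (rule obtain_velocity)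
  have "((\<lambda>t. \<xi> (dlam (c t) y)) has_vector_derivative \<xi> x * \<xi> (dlam p y)) (at 0)" for y
  proof -
    have "dlam (c t \<otimes>\<^bsub>H\<^esub> inv\<^bsub>H\<^esub> p) (dlam p y) = dlam (c t) y" for t
      unfolding dlam_circ[symmetric] by (simp add: circ.m_assoc)
    then show ?thesis
      using derivative_dlam[OF c' x[symmetric], of "dlam p y"] by simp
  qed
  then show ?thesis by blast
qed

definition multiplier :: "'a \<Rightarrow> complex \<Rightarrow> bool" where
  "multiplier g m \<longleftrightarrow> (\<forall>y. \<xi> (dlam g y) = m * \<xi> y)"

lemma multiplier_circ: "multiplier g m \<Longrightarrow> multiplier h n \<Longrightarrow> multiplier (g \<otimes>\<^bsub>H\<^esub> h) (m * n)"
  by (simp add: multiplier_def dlam_circ)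

lemma dlam_inv [simp]: "dlam g (dlam (inv\<^bsub>H\<^esub> g) y) = y" "dlam (inv\<^bsub>H\<^esub> g) (dlam g y) = y"
  by (simp_all flip: dlam_circ)

lemma multiplier_nonzero:
  assumes "multiplier g m" "\<xi> u \<noteq> 0" shows "m \<noteq> 0"
  using assms(1)[unfolded multiplier_def, rule_format, of "dlam (inv\<^bsub>H\<^esub> g) u"] assms(2) by auto

lemma multiplier_inv:
  assumes "multiplier g m" "\<xi> u \<noteq> 0" shows "multiplier (inv\<^bsub>H\<^esub> g) (inverse m)"
  unfolding multiplier_def
proof
  fix y
  have "\<xi> y = m * \<xi> (dlam (inv\<^bsub>H\<^esub> g) y)"
    using assms(1)[unfolded multiplier_def, rule_format, of "dlam (inv\<^bsub>H\<^esub> g) y"] by simp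
  then show "\<xi> (dlam (inv\<^bsub>H\<^esub> g) y) = inverse m * \<xi> y"
    using multiplier_nonzero[OF assms] by (simp add: field_simps)
qed

text \<open>Along any curve the functions \<open>g \<mapsto> \<xi> (dlam g y)\<close> for different \<open>y\<close> have the same logarithmic
  derivative, so their quotients are locally constant.\<close>

lemma multiplier_near_one:
  assumes u: "\<xi> u \<noteq> 0"
  obtains N where "open N" "\<one>\<^bsub>G\<^esub> \<in> N" "N \<subseteq> {g. \<exists>m. multiplier g m}"
proof -
  define E where "E y g = \<xi> (dlam g y)" for y g
  define N where "N = {g. E u g \<noteq> 0}"
  have "isCont (E u) p" for p
    unfolding E_def using top_atlas differentiable_dlam by (rule differentiable_at_point_isCont)
  then have "continuous_on UNIV (E u)" by (simp add: continuous_at_imp_continuous_on)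
  then have "open (E u -` (- {0}))" by (rule open_vimage[rotated]) (simp add: open_Compl)
  then have "open N" by (simp add: N_def vimage_def)
  moreover have "\<one>\<^bsub>G\<^esub> \<in> N" using u by (simp add: N_def E_def)
  ultimately show ?thesis
  proof (rule zero_derivative_locally_constant[OF atlas, where 'b = complex])
    fix N' assume N': "open N'" "\<one>\<^bsub>G\<^esub> \<in> N'" "N' \<subseteq> N" and
      const: "\<And>k q. (\<And>q. q \<in> N \<Longrightarrow> differentiable_at_point A q k) \<Longrightarrow>
        (\<And>q c. q \<in> N \<Longrightarrow> curve q c \<Longrightarrow> ((\<lambda>t. k (c t)) has_vector_derivative 0) (at 0)) \<Longrightarrow>
        q \<in> N' \<Longrightarrow> (k q :: complex) = k \<one>\<^bsub>G\<^esub>"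
    have "\<exists>m. multiplier g m" if g: "g \<in> N'" for g
    proof -
      have "E y g / E u g = E y \<one>\<^bsub>G\<^esub> / E u \<one>\<^bsub>G\<^esub>" for y
      proof (rule const[OF _ _ g])
        fix q assume q: "q \<in> N"
        show "differentiable_at_point A q (\<lambda>g. E y g / E u g)"
          unfolding E_def
          by (rule differentiable_at_point_divide[OF top_atlas differentiable_dlam differentiable_dlam])
            (use q in \<open>simp add: N_def E_def\<close>)
        fix c assume c: "curve q c"
        then obtain z where z: "\<And>y. ((\<lambda>t. E y (c t)) has_vector_derivative z * E y q) (at 0)"
          unfolding E_def using derivative_dlam_at by blast
        have c0: "c 0 = q" using c by (simp add: smooth_curve_at_def)
        have "((\<lambda>t. E y (c t) / E u (c t)) has_derivative
            (\<lambda>h. - E y (c 0) * (inverse (E u (c 0)) * (h *\<^sub>R (z * E u q)) * inverse (E u (c 0)))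
              + (h *\<^sub>R (z * E y q)) / E u (c 0))) (at 0)"
          using z[of y] z[of u] q unfolding has_vector_derivative_def
          by (intro has_derivative_divide) (auto simp: c0 N_def)
        moreover have "- E y (c 0) * (inverse (E u (c 0)) * (h *\<^sub>R (z * E u q)) * inverse (E u (c 0)))
              + (h *\<^sub>R (z * E y q)) / E u (c 0) = h *\<^sub>R 0" for h
          using q by (simp add: c0 N_def field_simps)
        ultimately show "((\<lambda>t. E y (c t) / E u (c t)) has_vector_derivative 0) (at 0)"
          unfolding has_vector_derivative_def by simp
      qed
      moreover have "E u g \<noteq> 0" using g N'(3) by (auto simp: N_def)
      ultimately have "multiplier g (E u g / \<xi> u)"
        using u unfolding multiplier_def by (simp add: E_def field_simps)
      then show ?thesis by blast
    qed
    then have "N' \<subseteq> {g. \<exists>m. multiplier g m}" by blast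
    with N'(1,2) show ?thesis by (rule that)
  qed
qed

text \<open>The elements with a multiplier form an open subgroup for the second product, and a connected
  group has no proper one.\<close>

lemma multiplier_exists:
  assumes u: "\<xi> u \<noteq> 0"
  shows "\<exists>m. multiplier g m"
proof -
  define Q where "Q = {g. \<exists>m. multiplier g m}"
  obtain N where N: "open N" "\<one>\<^bsub>G\<^esub> \<in> N" "N \<subseteq> {g. \<exists>m. multiplier g m}"
    using u by (rule multiplier_near_one)
  have NQ: "g \<in> Q" if "g \<in> N" for g using N(3) that by (auto simp: Q_def)
  have circ: "g \<otimes>\<^bsub>H\<^esub> h \<in> Q" if "g \<in> Q" "h \<in> Q" for g h
    using that multiplier_circ unfolding Q_def by blast
  have inv: "inv\<^bsub>H\<^esub> g \<in> Q" if "g \<in> Q" for g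
    using that multiplier_inv[OF _ u] unfolding Q_def by blast
  have cont: "continuous_on UNIV (\<lambda>k. k \<otimes>\<^bsub>H\<^esub> g)" for g
    using smooth_circ_right by (rule smooth_map_on_continuous)
  \<comment> \<open>the translate of \<open>N\<close> to a neighbourhood of \<open>h\<close>\<close>
  define T where "T h = (\<lambda>k. k \<otimes>\<^bsub>H\<^esub> inv\<^bsub>H\<^esub> h) -` N" for h
  have T: "open (T h)" "h \<in> T h" for h
    unfolding T_def using open_vimage[OF N(1) cont] N(2) by simp_all
  have sub: "T h \<subseteq> Q" if "h \<in> Q" for h
  proof
    fix k assume "k \<in> T h"
    then have "k \<otimes>\<^bsub>H\<^esub> inv\<^bsub>H\<^esub> h \<in> Q" unfolding T_def vimage_eq by (rule NQ)
    from circ[OF this that] show "k \<in> Q" by (simp add: circ.m_assoc)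
  qed
  have sub': "T h \<subseteq> - Q" if "h \<notin> Q" for h
  proof
    fix k assume "k \<in> T h"
    then have *: "k \<otimes>\<^bsub>H\<^esub> inv\<^bsub>H\<^esub> h \<in> Q" unfolding T_def vimage_eq by (rule NQ)
    have "k \<notin> Q"
    proof
      assume "k \<in> Q"
      from circ[OF inv[OF *] this] have "h \<in> Q" by (simp add: circ.inv_mult_group circ.m_assoc)
      with that show False by simp
    qed
    then show "k \<in> - Q" by simp
  qed
  have "open Q"
  proof (rule Topological_Spaces.openI)
    fix h assume "h \<in> Q"
    with T[of h] sub[of h] show "\<exists>X. open X \<and> h \<in> X \<and> X \<subseteq> Q" by blast
  qed
  moreover have "open (- Q)"
  proof (rule Topological_Spaces.openI)
    fix h assume "h \<in> - Q"
    with T[of h] sub'[of h] show "\<exists>X. open X \<and> h \<in> X \<and> X \<subseteq> - Q" by blast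
  qed
  moreover have "Q \<noteq> {}" using NQ[OF N(2)] by blast
  ultimately have "Q = UNIV"
    using connected_clopen[of "UNIV :: 'a set"] connected by (auto simp: closed_def)
  then show ?thesis unfolding Q_def by blast
qed

text \<open>The multiplier \<open>\<mu>\<close> is multiplicative for one group structure, and \<open>\<mu> - 1\<close> is additive for the
  other, because its derivative is left invariant there.\<close>

theorem character_trivial: "\<xi> u = 0"
proof (rule ccontr)
  assume u: "\<xi> u \<noteq> 0"
  define \<mu> where "\<mu> g = \<xi> (dlam g u) / \<xi> u" for g
  have mult_\<mu>: "multiplier g (\<mu> g)" for g
    using multiplier_exists[OF u, of g] u by (auto simp: \<mu>_def multiplier_def)
  have \<mu>: "\<xi> (dlam g y) = \<mu> g * \<xi> y" for g y
    using mult_\<mu>[of g] by (simp add: multiplier_def)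
  have \<mu>_circ: "\<mu> (g \<otimes>\<^bsub>H\<^esub> h) = \<mu> g * \<mu> h" for g h
    unfolding \<mu>_def[of "g \<otimes>\<^bsub>H\<^esub> h"] using u by (simp add: dlam_circ \<mu>)
  have \<mu>_nz: "\<mu> g \<noteq> 0" for g using mult_\<mu> u by (rule multiplier_nonzero)
  have \<mu>_one: "\<mu> \<one>\<^bsub>G\<^esub> = 1" using u by (simp add: \<mu>_def)
  have diff: "differentiable_at_point A p \<mu>" for p
  proof -
    have "differentiable_at_point A p (\<lambda>g. \<xi> u)"
      by (auto simp: differentiable_at_point_def comp_def)
    from differentiable_at_point_divide[OF top_atlas differentiable_dlam this u]
    show ?thesis unfolding \<mu>_def .
  qed
  \<comment> \<open>Seen through the left translations of the first group, \<open>\<mu>\<close> has derivative \<open>\<xi>\<close> everywhere: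
    the factor \<open>\<mu> p\<close> from multiplicativity is absorbed by passing from \<open>p \<circ> b(t)\<close> to
    \<open>p \<cdot> \<lambda>\<^sub>p(b(t))\<close>.\<close>
  have deriv: "((\<lambda>t. \<mu> (c t)) has_vector_derivative \<xi> x) (at 0)"
    if c: "curve p c" and x: "\<Phi> x = velocity A (\<lambda>t. inv\<^bsub>G\<^esub> p \<otimes>\<^bsub>G\<^esub> c t)" for p c x
  proof -
    define b where "b t = inv\<^bsub>H\<^esub> p \<otimes>\<^bsub>H\<^esub> c t" for t
    have "curve (inv\<^bsub>H\<^esub> p \<otimes>\<^bsub>H\<^esub> p) b"
      unfolding b_def using c smooth_circ_left by (rule curve_compose)
    then have b: "curve \<one>\<^bsub>G\<^esub> b" by simp
    then obtain w where w: "\<Phi> w = velocity A b" by (rule obtain_velocity)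
    have cb: "c t = p \<otimes>\<^bsub>H\<^esub> b t" for t
      unfolding b_def by (simp flip: circ.m_assoc)
    have "inv\<^bsub>G\<^esub> p \<otimes>\<^bsub>G\<^esub> c t = lam p (b t)" for t
      by (simp add: cb brace_lambda_def)
    then have "\<Phi> x = \<Phi> (dlam p w)"
      using \<Phi>_dlam_velocity[OF b w[symmetric], of p] x by simp
    then have x_eq: "x = dlam p w" by (simp add: \<Phi>_eq_iff)
    have "((\<lambda>t. (\<mu> p / \<xi> u) * \<xi> (dlam (b t) u)) has_vector_derivative (\<mu> p / \<xi> u) * (\<xi> w * \<xi> u)) (at 0)"
      by (rule has_vector_derivative_mult_right[OF derivative_dlam[OF b w[symmetric]]])
    moreover have "(\<mu> p / \<xi> u) * \<xi> (dlam (b t) u) = \<mu> (c t)" for t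
      using u by (simp add: cb \<mu>_circ \<mu>)
    ultimately show ?thesis using u by (simp add: x_eq \<mu>)
  qed
  have \<mu>_dot: "\<mu> (g \<otimes>\<^bsub>G\<^esub> h) = \<mu> g + \<mu> h - 1" for g h
  proof -
    define k where "k h = \<mu> (g \<otimes>\<^bsub>G\<^esub> h) - \<mu> h" for h
    have "k h = k \<one>\<^bsub>G\<^esub>"
    proof (rule zero_derivative_constant[OF atlas connected])
      show "differentiable_at_point A q k" for q
        unfolding k_def
        by (rule differentiable_at_point_diff[OF differentiable_at_point_compose[OF top_atlas top_atlas
              smooth_dot_left[of g] open_UNIV UNIV_I diff] diff])
      fix q c assume c: "curve q c"
      have gc: "curve (g \<otimes>\<^bsub>G\<^esub> q) (\<lambda>t. g \<otimes>\<^bsub>G\<^esub> c t)"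
        using c smooth_dot_left by (rule curve_compose)
      have "curve (inv\<^bsub>G\<^esub> q \<otimes>\<^bsub>G\<^esub> q) (\<lambda>t. inv\<^bsub>G\<^esub> q \<otimes>\<^bsub>G\<^esub> c t)"
        using c smooth_dot_left by (rule curve_compose)
      then have "curve \<one>\<^bsub>G\<^esub> (\<lambda>t. inv\<^bsub>G\<^esub> q \<otimes>\<^bsub>G\<^esub> c t)" by simp
      then obtain x where x: "\<Phi> x = velocity A (\<lambda>t. inv\<^bsub>G\<^esub> q \<otimes>\<^bsub>G\<^esub> c t)" by (rule obtain_velocity)
      have "inv\<^bsub>G\<^esub> g \<otimes>\<^bsub>G\<^esub> (g \<otimes>\<^bsub>G\<^esub> c t) = c t" for t
        by (simp flip: dot.m_assoc)
      then have "inv\<^bsub>G\<^esub> (g \<otimes>\<^bsub>G\<^esub> q) \<otimes>\<^bsub>G\<^esub> (g \<otimes>\<^bsub>G\<^esub> c t) = inv\<^bsub>G\<^esub> q \<otimes>\<^bsub>G\<^esub> c t" for t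
        by (simp add: dot.inv_mult_group dot.m_assoc)
      then have "((\<lambda>t. \<mu> (g \<otimes>\<^bsub>G\<^esub> c t)) has_vector_derivative \<xi> x) (at 0)"
        using deriv[OF gc, of x] x by simp
      from has_vector_derivative_diff[OF this deriv[OF c x]]
      show "((\<lambda>t. k (c t)) has_vector_derivative 0) (at 0)" by (simp add: k_def)
    qed
    then show ?thesis by (simp add: k_def \<mu>_one algebra_simps)
  qed
  \<comment> \<open>Hence the values of \<open>\<mu> - 1\<close> form a subring of the complex numbers that omits \<open>-1\<close>.\<close>
  define W where "W = range (\<lambda>g. \<mu> g - 1)"
  obtain c where c: "curve \<one>\<^bsub>G\<^esub> c" "velocity A c = \<Phi> u" by (rule obtain_curve)
  obtain e where c0: "c 0 = \<one>\<^bsub>G\<^esub>" and e: "e > 0" "smooth_map_on standard_atlas A {-e<..<e} c"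
    using c(1) unfolding smooth_curve_at_def by blast
  have add: "v + w \<in> W" if "v \<in> W" "w \<in> W" for v w
  proof -
    obtain g h where "v = \<mu> g - 1" "w = \<mu> h - 1"
      using \<open>v \<in> W\<close> \<open>w \<in> W\<close> unfolding W_def by blast
    then have "v + w = \<mu> (g \<otimes>\<^bsub>G\<^esub> h) - 1" by (simp add: \<mu>_dot)
    then show ?thesis by (simp add: W_def)
  qed
  have neg: "- w \<in> W" if "w \<in> W" for w
  proof -
    obtain g where "w = \<mu> g - 1" using \<open>w \<in> W\<close> unfolding W_def by blast
    moreover have "\<mu> (inv\<^bsub>G\<^esub> g) = 2 - \<mu> g"
      using \<mu>_dot[of g "inv\<^bsub>G\<^esub> g"] by (simp add: \<mu>_one algebra_simps)
    ultimately have "- w = \<mu> (inv\<^bsub>G\<^esub> g) - 1" by simp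
    then show ?thesis by (simp add: W_def)
  qed
  have mult: "v * w \<in> W" if "v \<in> W" "w \<in> W" for v w
  proof -
    obtain g h where gh: "v = \<mu> g - 1" "w = \<mu> h - 1"
      using \<open>v \<in> W\<close> \<open>w \<in> W\<close> unfolding W_def by blast
    have "v * w = (\<mu> (g \<otimes>\<^bsub>H\<^esub> h) - 1) + (- v + - w)"
      unfolding gh \<mu>_circ by (simp add: algebra_simps)
    also have "\<dots> \<in> W"
      by (rule add[OF _ add[OF neg neg]]) (use that in \<open>simp_all add: W_def\<close>)
    finally show ?thesis .
  qed
  have minus_one: "-1 \<notin> W" using \<mu>_nz by (auto simp: W_def)
  have cont: "continuous_on {-e<..<e} (\<lambda>t. \<mu> (c t) - 1)"
  proof -
    have "continuous_on UNIV \<mu>"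
      using differentiable_at_point_isCont[OF top_atlas diff] by (simp add: continuous_at_imp_continuous_on)
    from continuous_on_compose2[OF this smooth_map_on_continuous[OF e(2)]]
    show ?thesis by (intro continuous_on_diff continuous_on_const) simp
  qed
  have "((\<lambda>t. \<mu> (c t) - 1) has_vector_derivative \<xi> u) (at 0)"
    using has_vector_derivative_diff[OF deriv[OF c(1), of u] has_vector_derivative_const[of 1]] c(2) by simp
  then have "\<xi> u = 0"
    by (rule subring_without_minus_one_no_curve[OF add neg mult minus_one _ _ _ cont, rotated -1])
      (use e(1) in \<open>auto simp: W_def c0 \<mu>_one\<close>)
  with u show False by simp
qed

end

section \<open>Common eigenvectors of a nilpotent Lie algebra\<close>

locale complex_vector_space = vector_space scale
  for scale :: "complex \<Rightarrow> 'b::ab_group_add \<Rightarrow> 'b" (infixr "*c" 75)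
begin

definition operator :: "('b \<Rightarrow> 'b) \<Rightarrow> bool" where
  "operator T \<longleftrightarrow> (\<forall>u w. T (u + w) = T u + T w) \<and> (\<forall>c u. T (c *c u) = c *c T u)"

lemma operator_add: "operator T \<Longrightarrow> T (u + w) = T u + T w"
  and operator_scale: "operator T \<Longrightarrow> T (c *c u) = c *c T u"
  by (simp_all add: operator_def)

lemma operator_0: "operator T \<Longrightarrow> T 0 = 0"
  using operator_scale[of T 0 0] by simp

lemma operator_diff: "operator T \<Longrightarrow> T (u - w) = T u - T w"
  using operator_add[of T "u - w" w] by (simp add: eq_diff_eq)

text \<open>Otherwise the vectors \<open>v n\<close> would form an infinite independent set.\<close>

lemma dependent_sequence:
  assumes W: "W \<subseteq> span B" "finite B" and v: "\<And>n :: nat. v n \<in> W"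
  shows "\<exists>n. v n \<in> span (v ` {..<n})"
proof (rule ccontr)
  assume "\<not> ?thesis"
  then have not: "v n \<notin> span (v ` {..<n})" for n by simp
  have *: "independent (v ` {..<n}) \<and> card (v ` {..<n}) = n" for n :: nat
  proof (induction n)
    case (Suc n)
    have "v n \<notin> v ` {..<n}" using not[of n] by (rule contrapos_nn) (rule span_base)
    then show ?case
      using Suc.IH independent_insertI[OF not[of n]] by (simp add: lessThan_Suc)
  qed (simp add: independent_empty)
  have "v ` {..<Suc (card B)} \<subseteq> span B" using W(1) v by auto
  with *[of "Suc (card B)"] show False
    using independent_span_bound[OF W(2), of "v ` {..<Suc (card B)}"] by simp
qed

text \<open>The vector \<open>p(T) v\<close>, by Horner's scheme.\<close>

definition poly_apply :: "('b \<Rightarrow> 'b) \<Rightarrow> complex poly \<Rightarrow> 'b \<Rightarrow> 'b" where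
  "poly_apply T p v = fold_coeffs (\<lambda>a w. a *c v + T w) p 0"

context
  fixes T :: "'b \<Rightarrow> 'b" and v :: 'b
  assumes T: "operator T"
begin

lemma poly_apply_0 [simp]: "poly_apply T 0 v = 0"
  by (simp add: poly_apply_def)

lemma poly_apply_pCons: "poly_apply T (pCons a p) v = a *c v + T (poly_apply T p v)"
  by (cases "p = 0 \<and> a = 0") (auto simp: poly_apply_def operator_0[OF T])

lemma poly_apply_add: "poly_apply T (p + q) v = poly_apply T p v + poly_apply T q v"
  by (induction p q rule: poly_induct2)
    (simp_all add: poly_apply_pCons operator_add[OF T] scale_left_distrib)

lemma poly_apply_smult: "poly_apply T (smult c p) v = c *c poly_apply T p v"
  by (induction p) (simp_all add: poly_apply_pCons operator_scale[OF T] scale_right_distrib)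

lemma poly_apply_linear_factor:
  "poly_apply T ([:- r, 1:] * q) v = T (poly_apply T q v) - r *c poly_apply T q v"
proof -
  have "poly_apply T ([:- r, 1:] * q) v = poly_apply T (smult (- r) q + pCons 0 q) v" by simp
  also have "\<dots> = T (poly_apply T q v) - r *c poly_apply T q v"
    unfolding poly_apply_add poly_apply_smult poly_apply_pCons by simp
  finally show ?thesis .
qed

lemma poly_apply_monom: "poly_apply T (monom 1 n) v = (T ^^ n) v"
  by (induction n) (simp_all add: monom_0 monom_Suc poly_apply_pCons operator_0[OF T])

lemma poly_apply_in_subspace:
  "subspace U \<Longrightarrow> v \<in> U \<Longrightarrow> T ` U \<subseteq> U \<Longrightarrow> poly_apply T p v \<in> U"
  by (induction p) (auto simp: poly_apply_pCons subspace_0 intro!: subspace_add subspace_scale)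

text \<open>Some \<open>(T ^^ n) v\<close> depends on its predecessors, and so it is the value of a polynomial \<open>q\<close> whose
  coefficient at \<open>n\<close> vanishes. Subtracting \<open>q\<close> from the monomial of degree \<open>n\<close> gives \<open>p\<close>.\<close>

lemma annihilating_polynomial:
  assumes "subspace U" "U \<subseteq> span B" "finite B" "T ` U \<subseteq> U" "v \<in> U"
  obtains p where "p \<noteq> 0" "poly_apply T p v = 0"
proof -
  have "(T ^^ n) v \<in> U" for n
    by (induction n) (use assms in auto)
  then obtain n where n: "(T ^^ n) v \<in> span ((\<lambda>n. (T ^^ n) v) ` {..<n})"
    using dependent_sequence[OF assms(2,3), of "\<lambda>n. (T ^^ n) v"] by auto
  have "span ((\<lambda>n. (T ^^ n) v) ` {..<n}) \<subseteq> (\<lambda>q. poly_apply T q v) ` {q. coeff q n = 0}"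
  proof (rule span_minimal)
    show "(\<lambda>n. (T ^^ n) v) ` {..<n} \<subseteq> (\<lambda>q. poly_apply T q v) ` {q. coeff q n = 0}"
      by (auto simp: poly_apply_monom[symmetric])
    show "subspace ((\<lambda>q. poly_apply T q v) ` {q. coeff q n = 0})"
    proof (rule subspaceI)
      show "0 \<in> (\<lambda>q. poly_apply T q v) ` {q. coeff q n = 0}" by (auto intro!: image_eqI[of _ _ 0])
    qed (auto simp flip: poly_apply_add poly_apply_smult)
  qed
  then obtain q where q: "coeff q n = 0" "(T ^^ n) v = poly_apply T q v" using n by blast
  have "coeff (monom 1 n + smult (- 1) q) n \<noteq> 0" using q(1) by simp
  then have "monom 1 n + smult (- 1) q \<noteq> 0" by (metis coeff_0)
  moreover have "poly_apply T (monom 1 n + smult (- 1) q) v = 0"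
    unfolding poly_apply_add poly_apply_smult poly_apply_monom q(2) by simp
  ultimately show ?thesis by (rule that)
qed

end

text \<open>Split a linear factor \<open>X - r\<close> off an annihilating polynomial of least degree; the cofactor
  does not annihilate \<open>v\<close>, and its value is an eigenvector for \<open>r\<close>.\<close>

lemma eigenvector_exists:
  assumes T: "operator T" and U: "subspace U" "U \<subseteq> span B" "finite B" "T ` U \<subseteq> U"
    and v: "v \<in> U" "v \<noteq> 0"
  obtains w c where "w \<in> U" "w \<noteq> 0" "T w = c *c w"
proof -
  have "\<exists>p. p \<noteq> 0 \<and> poly_apply T p v = 0"
    using annihilating_polynomial[OF T U v(1)] by metis
  then obtain p where p: "p \<noteq> 0" "poly_apply T p v = 0"
    and least: "\<And>q. q \<noteq> 0 \<and> poly_apply T q v = 0 \<Longrightarrow> degree p \<le> degree q"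
    using ex_has_least_nat[of "\<lambda>p. p \<noteq> 0 \<and> poly_apply T p v = 0" _ degree] by blast
  have "degree p \<noteq> 0"
  proof
    assume "degree p = 0"
    then obtain c where c: "p = [:c:]" by (rule degree_eq_zeroE)
    then have "c *c v = 0" using p(2) by (simp add: poly_apply_pCons[OF T] operator_0[OF T] poly_apply_0[OF T])
    with c p(1) v(2) show False by simp
  qed
  then obtain r where "poly p r = 0"
    using fundamental_theorem_of_algebra[of p] by (auto simp: constant_degree)
  then obtain q where q: "p = [:- r, 1:] * q" by (metis poly_eq_0_iff_dvd dvdE)
  then have "q \<noteq> 0" using p(1) by auto
  then have "degree p = Suc (degree q)" unfolding q by (subst degree_mult_eq) auto
  then have "poly_apply T q v \<noteq> 0" using least[of q] \<open>q \<noteq> 0\<close> by fastforce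
  moreover have "poly_apply T q v \<in> U"
    using T U(1) v(1) U(4) by (rule poly_apply_in_subspace)
  moreover have "T (poly_apply T q v) = r *c poly_apply T q v"
    using p(2) unfolding q poly_apply_linear_factor[OF T] by simp
  ultimately show ?thesis using that by blast
qed

lemma operator_funpow: "operator T \<Longrightarrow> operator (T ^^ n)"
  by (induction n) (auto simp: operator_def)

lemma operator_shift: "operator T \<Longrightarrow> operator (\<lambda>u. T u - b *c u)"
  by (simp add: operator_def scale_right_distrib scale_right_diff_distrib scale_left_commute)

text \<open>In place of the trace, the Weyl relation: let \<open>v\<close> be an eigenvector of \<open>T\<close>, let \<open>N = T - b\<close> kill it,
  and put \<open>w n = (A ^^ n) v\<close>. Then \<open>N (w (Suc n))\<close> is \<open>- (Suc n) * s\<close> times \<open>w n\<close>, so for \<open>s \<noteq> 0\<close> the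
  power \<open>N ^^ n\<close> kills \<open>w i\<close> for all \<open>i < n\<close> but not \<open>w n\<close>. This makes the vectors \<open>w n\<close> independent.\<close>

lemma scalar_commutator_zero:
  assumes A: "operator A" and T: "operator T"
    and U: "subspace U" "U \<subseteq> span B" "finite B" "A ` U \<subseteq> U" "T ` U \<subseteq> U" "u \<in> U" "u \<noteq> 0"
    and comm: "\<And>w. w \<in> U \<Longrightarrow> A (T w) - T (A w) = s *c w"
  shows "s = 0"
proof (rule ccontr)
  assume "s \<noteq> 0"
  obtain v b where v: "v \<in> U" "v \<noteq> 0" "T v = b *c v"
    using eigenvector_exists[OF T U(1,2,3,5,6,7)] by blast
  define N where "N u = T u - b *c u" for u
  have N: "operator N" unfolding N_def using T by (rule operator_shift)
  define w where "w n = (A ^^ n) v" for n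
  have wU: "w n \<in> U" for n
    by (induction n) (use U(4) v(1) in \<open>auto simp: w_def\<close>)
  have A_w: "A (w n) = w (Suc n)" for n by (simp add: w_def)
  have N_w_0: "N (w 0) = 0" by (simp add: w_def N_def v(3))
  have N_A: "N (A u) = A (N u) - s *c u" if "u \<in> U" for u
    using comm[OF that] unfolding N_def operator_diff[OF A] operator_scale[OF A]
    by (simp add: algebra_simps)
  have N_w: "N (w (Suc n)) = (- (of_nat (Suc n) * s)) *c w n" for n
  proof (induction n)
    case 0
    show ?case using N_A[OF wU[of 0]] by (simp add: A_w N_w_0 operator_0[OF A])
  next
    case (Suc n)
    have "N (w (Suc (Suc n))) = (- (of_nat (Suc n) * s)) *c w (Suc n) - s *c w (Suc n)"
      using N_A[OF wU[of "Suc n"]] by (simp only: A_w Suc operator_scale[OF A])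
    also have "\<dots> = (- (of_nat (Suc n) * s) - s) *c w (Suc n)" by (simp only: scale_left_diff_distrib)
    also have "- (of_nat (Suc n) * s) - s = - (of_nat (Suc (Suc n)) * s)" by (simp add: algebra_simps)
    finally show ?case .
  qed
  have top: "\<exists>c. c \<noteq> 0 \<and> (N ^^ n) (w n) = c *c v" for n
  proof (induction n)
    case 0
    show ?case by (rule exI[of _ 1]) (simp add: w_def)
  next
    case (Suc n)
    then obtain c where c: "c \<noteq> 0" "(N ^^ n) (w n) = c *c v" by blast
    have "(N ^^ Suc n) (w (Suc n)) = (N ^^ n) (N (w (Suc n)))" by (simp only: funpow_Suc_right comp_def)
    also have "\<dots> = (- (of_nat (Suc n) * s)) *c (c *c v)"
      unfolding N_w operator_scale[OF operator_funpow[OF N]] c(2) ..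
    finally have "(N ^^ Suc n) (w (Suc n)) = (- (of_nat (Suc n) * s) * c) *c v" by simp
    moreover have "- (of_nat (Suc n) * s) * c \<noteq> 0"
      using \<open>s \<noteq> 0\<close> c(1) by (simp del: of_nat_Suc)
    ultimately show ?case by blast
  qed
  have "N v = 0" using N_w_0 by (simp add: w_def)
  have low: "(N ^^ n) (w i) = 0" if "i < n" for i n
  proof -
    obtain c where "(N ^^ i) (w i) = c *c v" using top by blast
    then have "(N ^^ Suc i) (w i) = 0" by (simp add: operator_scale[OF N] \<open>N v = 0\<close>)
    moreover have "(N ^^ n) (w i) = (N ^^ (n - Suc i)) ((N ^^ Suc i) (w i))"
      using that by (metis Suc_leI add.commute comp_apply funpow_add le_add_diff_inverse)
    ultimately show ?thesis by (simp only: operator_0[OF operator_funpow[OF N]])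
  qed
  have "w n \<notin> span (w ` {..<n})" for n
  proof
    assume "w n \<in> span (w ` {..<n})"
    moreover have "span (w ` {..<n}) \<subseteq> {x. (N ^^ n) x = 0}"
      by (rule span_minimal)
        (auto simp: low operator_funpow[OF N] operator_0 operator_add operator_scale intro!: subspaceI)
    ultimately have "(N ^^ n) (w n) = 0" by blast
    with top[of n] v(2) show False by auto
  qed
  then show False using dependent_sequence[where v = w, OF U(2,3) wU] by blast
qed

lemma minimal_invariant_subspace:
  fixes T :: "'i \<Rightarrow> 'b \<Rightarrow> 'b"
  assumes "subspace W" "W \<subseteq> span B" "finite B" "W \<noteq> {0}" "\<And>x. T x ` W \<subseteq> W"
  obtains U where "subspace U" "U \<subseteq> W" "U \<noteq> {0}" "\<forall>x. T x ` U \<subseteq> U"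
    and "\<forall>V. subspace V \<and> V \<subseteq> U \<and> V \<noteq> {0} \<and> (\<forall>x. T x ` V \<subseteq> V) \<longrightarrow> V = U"
proof -
  define P where "P U \<longleftrightarrow> subspace U \<and> U \<subseteq> W \<and> U \<noteq> {0} \<and> (\<forall>x. T x ` U \<subseteq> U)" for U
  have "P W" using assms by (auto simp: P_def)
  then obtain U where U: "P U" and least: "\<And>V. P V \<Longrightarrow> dim U \<le> dim V"
    using ex_has_least_nat[of P W dim] by blast
  have "V = U" if V: "subspace V" "V \<subseteq> U" "V \<noteq> {0}" "\<And>x. T x ` V \<subseteq> V" for V
  proof (rule ccontr)
    assume "V \<noteq> U"
    then obtain u where u: "u \<in> U" "u \<notin> V" using V(2) by blast
    obtain D where D: "D \<subseteq> V" "independent D" "V \<subseteq> span D" "card D = dim V" by (rule basis_exists)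
    obtain C where C: "C \<subseteq> U" "independent C" "U \<subseteq> span C" "card C = dim U" by (rule basis_exists)
    have UW: "U \<subseteq> W" using U by (simp add: P_def)
    have fin: "finite D" "finite C"
      using independent_span_bound[OF assms(3) D(2)] independent_span_bound[OF assms(3) C(2)]
        D(1) C(1) V(2) UW assms(2) by blast+
    have "u \<notin> span D" using u(2) D(1) V(1) span_minimal[of D V] by blast
    then have "independent (insert u D)" using D(2) by (rule independent_insertI)
    moreover have "card (insert u D) = Suc (dim V)"
      unfolding D(4)[symmetric] using u(2) D(1) fin(1) by (intro card_insert_disjoint) auto
    moreover have "insert u D \<subseteq> span C" using u D(1) C(3) V(2) by blast
    ultimately have "Suc (dim V) \<le> dim U"
      using independent_span_bound[OF fin(2)] C(4) by metis
    moreover have "P V" using V UW U by (auto simp: P_def)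
    ultimately show False using least[of V] by simp
  qed
  then show ?thesis using that[of U] U by (auto simp: P_def)
qed

text \<open>Lie's theorem for nilpotent Lie algebras. On a minimal invariant subspace \<open>U\<close> every \<open>T z\<close> is a
  scalar, by descending induction along the lower central series: if the operators of all \<open>br x z\<close> are
  scalars on \<open>U\<close>, these are commutators and hence \<open>0\<close>, so \<open>T z\<close> commutes with all \<open>T x\<close>, and its
  eigenspace is invariant. The sign of the bracket fits operators that act by precomposition.\<close>

lemma nilpotent_common_eigenvector:
  fixes T :: "'g::real_vector \<Rightarrow> 'b \<Rightarrow> 'b"
  assumes W: "subspace W" "W \<subseteq> span B" "finite B" "W \<noteq> {0}" "\<And>x. T x ` W \<subseteq> W"
    and T: "\<And>x. operator (T x)" and T0: "\<And>w. w \<in> W \<Longrightarrow> T 0 w = 0"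
    and br: "\<And>x y w. w \<in> W \<Longrightarrow> T (br x y) w = T y (T x w) - T x (T y w)"
    and nil: "nilpotent_lie br"
  obtains w c where "w \<in> W" "w \<noteq> 0" "\<And>x. T x w = c x *c w"
proof -
  obtain U where U: "subspace U" "U \<subseteq> W" "U \<noteq> {0}" "\<forall>x. T x ` U \<subseteq> U"
    and minimal: "\<forall>V. subspace V \<and> V \<subseteq> U \<and> V \<noteq> {0} \<and> (\<forall>x. T x ` V \<subseteq> V) \<longrightarrow> V = U"
    by (rule minimal_invariant_subspace[where T = T, OF W])
  have inv: "T x ` U \<subseteq> U" for x using U(4) by blast
  have UB: "U \<subseteq> span B" using U(2) W(2) by blast
  obtain u where u: "u \<in> U" "u \<noteq> 0" using U(3) subspace_0[OF U(1)] by blast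
  obtain n where n: "lower_central_series br n = {0}" using nil by (auto simp: nilpotent_lie_def)
  have "\<forall>z\<in>lower_central_series br 0. \<exists>c. \<forall>w\<in>U. T z w = c *c w"
  proof (rule inc_induct[of 0 n])
    show "\<forall>z\<in>lower_central_series br n. \<exists>c. \<forall>w\<in>U. T z w = c *c w"
      using U(2) by (auto simp: n T0 subset_iff intro!: exI[of _ 0])
  next
    fix k assume IH: "\<forall>z\<in>lower_central_series br (Suc k). \<exists>c. \<forall>w\<in>U. T z w = c *c w"
    show "\<forall>z\<in>lower_central_series br k. \<exists>c. \<forall>w\<in>U. T z w = c *c w"
    proof
      fix z assume z: "z \<in> lower_central_series br k"
      have comm: "T z (T x w) = T x (T z w)" if "w \<in> U" for x w
      proof -
        have "br x z \<in> lower_central_series br (Suc k)"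
          using z by (auto intro: real_vector.span_base)
        then obtain c where c: "\<forall>w\<in>U. T (br x z) w = c *c w" using IH by blast
        have *: "T z (T x w) - T x (T z w) = c *c w" if "w \<in> U" for w
          using c br[of w x z] that U(2) by auto
        have "c = 0"
          using scalar_commutator_zero[OF T T U(1) UB W(3) inv inv u *] .
        then show ?thesis using *[OF that] by simp
      qed
      obtain v b where v: "v \<in> U" "v \<noteq> 0" "T z v = b *c v"
        using eigenvector_exists[OF T U(1) UB W(3) inv u] by blast
      have "{w \<in> U. T z w = b *c w} = U"
      proof (rule minimal[rule_format], intro conjI allI)
        show "subspace {w \<in> U. T z w = b *c w}"
          using U(1) by (intro subspaceI)
            (auto simp: subspace_0 subspace_add subspace_scale operator_0[OF T] operator_add[OF T]
              operator_scale[OF T] scale_right_distrib scale_left_commute)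
        show "T x ` {w \<in> U. T z w = b *c w} \<subseteq> {w \<in> U. T z w = b *c w}" for x
          using inv by (auto simp: comm operator_scale[OF T])
        show "{w \<in> U. T z w = b *c w} \<noteq> {0}" using v by blast
      qed blast
      then show "\<exists>c. \<forall>w\<in>U. T z w = c *c w" by blast
    qed
  qed simp
  then have "\<exists>c. \<forall>w\<in>U. T x w = c *c w" for x by simp
  then have "\<exists>c. T x u = c *c u" for x using u(1) by blast
  then obtain c where "\<And>x. T x u = c x *c u" by metis
  with u U(2) show ?thesis using that by blast
qed

end

section \<open>Functionals on nilpotent post-Lie algebras\<close>

interpretation functional: complex_vector_space "\<lambda>c (f :: 'g \<Rightarrow> complex) x. c * f x"
  by unfold_locales (auto simp: fun_eq_iff algebra_simps)

lemma linear_functionals_finite_dimensional: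
  assumes "\<exists>B :: 'g::real_vector set. finite B \<and> span B = UNIV"
  obtains E :: "('g::real_vector \<Rightarrow> complex) set" where "finite E" "{f. linear f} \<subseteq> functional.span E"
proof -
  obtain B0 :: "'g set" where B0: "finite B0" "span B0 = UNIV" using assms by blast
  obtain B where "B \<subseteq> (UNIV :: 'g set)" and B: "independent B" "UNIV \<subseteq> span B"
    by (rule basis_exists)
  have "finite B" using independent_span_bound[OF B0(1) B(1)] B0(2) by simp
  define e where "e b x = complex_of_real (representation B x b)" for b x
  have "f \<in> functional.span (e ` B)" if f: "linear f" for f
  proof -
    have sum_apply: "(\<Sum>b\<in>B. g b) x = (\<Sum>b\<in>B. g b x)" for g :: "'g \<Rightarrow> 'g \<Rightarrow> complex" and x
      using \<open>finite B\<close> by (induction B) auto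
    have "f x = (\<Sum>b\<in>B. f b * e b x)" for x
    proof -
      have "f x = f (\<Sum>b\<in>B. representation B x b *\<^sub>R b)"
        using real_vector.sum_representation_eq[OF B(1) subsetD[OF B(2) UNIV_I] \<open>finite B\<close> order_refl]
        by simp
      also have "\<dots> = (\<Sum>b\<in>B. f b * e b x)"
        unfolding linear_sum[OF f] linear_cmul[OF f] by (simp add: e_def scaleR_conv_of_real mult.commute)
      finally show ?thesis .
    qed
    then have "f = (\<Sum>b\<in>B. (\<lambda>x. f b * e b x))"
      unfolding fun_eq_iff sum_apply by (rule allI)
    also have "\<dots> \<in> functional.span (e ` B)"
      by (intro functional.span_sum functional.span_scale functional.span_base imageI)
    finally show ?thesis .
  qed
  then have "{f. linear f} \<subseteq> functional.span (e ` B)" by blast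
  with finite_imageI[OF \<open>finite B\<close>] show ?thesis by (rule that)
qed

lemma functional_vanishing_on_subspace:
  assumes "subspace S" "S \<noteq> (UNIV :: 'g::real_vector set)"
  obtains l :: "'g::real_vector \<Rightarrow> real" and u where "linear l" "\<And>x. x \<in> S \<Longrightarrow> l x = 0" "l u \<noteq> 0"
proof -
  obtain u where u: "u \<notin> S" using assms(2) by blast
  obtain B where B: "B \<subseteq> S" "independent B" "S \<subseteq> span B" by (rule basis_exists)
  have uB: "u \<notin> span B" using u span_minimal[OF B(1) assms(1)] by blast
  then have "independent (insert u B)" using B(2) by (rule independent_insertI)
  from linear_independent_extend[OF this, of "\<lambda>x. if x = u then 1 else 0 :: real"]
  obtain l :: "'g \<Rightarrow> real" where l: "linear l" "\<forall>x\<in>insert u B. l x = (if x = u then 1 else 0)"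
    by (elim exE conjE) (rule that)
  have "l x = 0" if "x \<in> S" for x
  proof (rule linear_eq_0_on_span[OF l(1)])
    show "x \<in> span B" using that B(3) by blast
    show "l b = 0" if "b \<in> B" for b
    proof -
      have "b \<noteq> u" using span_base[OF that] uB by metis
      then show ?thesis using l(2) that by simp
    qed
  qed
  moreover have "l u \<noteq> 0" using l(2) by simp
  ultimately show ?thesis by (rule that[OF l(1)])
qed

text \<open>Otherwise the lower central series would be constant.\<close>

lemma nilpotent_derived_algebra_proper:
  assumes "nilpotent_lie br" "(UNIV :: 'g::real_vector set) \<noteq> {0}"
  shows "span {br x y | x y. True} \<noteq> (UNIV :: 'g::real_vector set)"
proof
  assume eq: "span {br x y | x y. True} = UNIV"
  have "lower_central_series br n = UNIV" for n
    by (induction n) (use eq in simp_all)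
  then show False using assms by (auto simp: nilpotent_lie_def)
qed

context post_lie_algebra
begin

lemma circ_eq: "circ x y = dot x y + tri x y - tri y x"
  using circ_minus_dot[of x y] by (simp add: algebra_simps)

lemma tri_add_left: "tri (x + y) z = tri x z + tri y z"
  and tri_add_right: "tri x (y + z) = tri x y + tri x z"
  and tri_scale_left: "tri (r *\<^sub>R x) y = r *\<^sub>R tri x y"
  and tri_scale_right: "tri x (r *\<^sub>R y) = r *\<^sub>R tri x y"
  and tri_zero_left: "tri 0 y = 0"
  using tri_bilinear by (simp_all add: bilinear_ladd bilinear_radd bilinear_lmul bilinear_rmul bilinear_lzero)

text \<open>Functionals that kill \<open>dot\<close> stay so under precomposition with \<open>tri x\<close>, since \<open>tri x\<close> is a
  derivation of \<open>dot\<close>.\<close>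

lemma eigenfunctional_exists:
  assumes "nilpotent_lie dot" "nilpotent_lie circ" "(UNIV :: 'g set) \<noteq> {0}"
  obtains \<xi> :: "'g \<Rightarrow> complex" and \<kappa> where "linear \<xi>" "\<xi> \<noteq> 0"
    "\<forall>x y. \<xi> (dot x y) = 0" "\<forall>x y. \<xi> (tri x y) = \<kappa> x * \<xi> y"
proof -
  define W where "W = {f :: 'g \<Rightarrow> complex. linear f \<and> (\<forall>x y. f (dot x y) = 0)}"
  define T :: "'g \<Rightarrow> ('g \<Rightarrow> complex) \<Rightarrow> 'g \<Rightarrow> complex" where "T x f = (\<lambda>z. f (tri x z))" for x f
  obtain E :: "('g \<Rightarrow> complex) set" where E: "finite E" "{f. linear f} \<subseteq> functional.span E"
    by (rule linear_functionals_finite_dimensional[OF finite_dimensional])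
  have "subspace (span {dot x y | x y. True})" by simp
  then obtain l :: "'g \<Rightarrow> real" and u where l: "linear l" "\<And>x. x \<in> span {dot x y | x y. True} \<Longrightarrow> l x = 0" "l u \<noteq> 0"
    using nilpotent_derived_algebra_proper[OF assms(1,3)] by (rule functional_vanishing_on_subspace) blast
  have "(\<lambda>x. complex_of_real (l x)) \<in> W"
    unfolding W_def using l(1) l(2)[OF span_base] by (auto simp: linear_iff scaleR_conv_of_real)
  moreover have "(\<lambda>x. complex_of_real (l x)) \<noteq> 0" using l(3) by (auto simp: fun_eq_iff)
  ultimately have W0: "W \<noteq> {0}" by blast
  have subspace: "functional.subspace W"
    by (rule functional.subspaceI) (auto simp: W_def linear_iff algebra_simps)
  have WE: "W \<subseteq> functional.span E" using E(2) by (auto simp: W_def)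
  have inv: "T x ` W \<subseteq> W" for x
    by (auto simp: W_def T_def linear_iff tri_add_right tri_scale_right tri_derivation)
  have op: "functional.operator (T x)" for x
    by (auto simp: functional.operator_def T_def fun_eq_iff)
  have T0: "T 0 f = 0" if "f \<in> W" for f
    using that by (auto simp: W_def T_def fun_eq_iff tri_zero_left linear_0)
  have br: "T (circ x y) f = T y (T x f) - T x (T y f)" if "f \<in> W" for x y f
    using that by (auto simp: W_def T_def fun_eq_iff tri_circ linear_diff)
  obtain f c where f: "f \<in> W" "f \<noteq> 0" "\<forall>x. T x f = (\<lambda>z. c x * f z)"
    using functional.nilpotent_common_eigenvector[OF subspace WE E(1) W0 inv op T0 br assms(2)] by blast
  show ?thesis
  proof (rule that[of f c])
    show "\<forall>x y. f (tri x y) = c x * f y" using f(3) by (simp add: T_def fun_eq_iff)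
  qed (use f(1,2) in \<open>auto simp: W_def\<close>)
qed

text \<open>Since \<open>\<kappa>\<close> kills \<open>circ\<close>, the functional \<open>\<eta>\<close>, which is \<open>\<xi>\<close> minus the multiple of \<open>\<kappa>\<close> that agrees
  with it at \<open>e\<close>, satisfies \<open>\<eta> (circ e y) = \<kappa> e * \<eta> y\<close>. As \<open>circ e\<close> is nilpotent and \<open>\<kappa> e \<noteq> 0\<close>, it
  vanishes.\<close>

lemma eigenvalue_multiplicative:
  fixes \<xi> :: "'g \<Rightarrow> complex"
  assumes \<xi>: "linear \<xi>" "\<xi> \<noteq> 0" "\<And>x y. \<xi> (dot x y) = 0" "\<And>x y. \<xi> (tri x y) = \<kappa> x * \<xi> y"
    and nil: "nilpotent_lie circ" and e: "\<kappa> e \<noteq> 0"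
  shows "linear \<kappa>" "\<kappa> (tri x y) = \<kappa> x * \<kappa> y"
proof -
  obtain u where u: "\<xi> u \<noteq> 0" using \<xi>(2) by (auto simp: fun_eq_iff)
  have \<kappa>: "\<kappa> x = \<xi> (tri x u) / \<xi> u" for x using u by (simp add: \<xi>(4))
  show "linear \<kappa>"
    unfolding linear_iff
    by (simp add: \<kappa> tri_add_left tri_scale_left linear_add[OF \<xi>(1)] linear_cmul[OF \<xi>(1)] add_divide_distrib
        scaleR_conv_of_real)
  have \<xi>_circ: "\<xi> (circ x y) = \<kappa> x * \<xi> y - \<kappa> y * \<xi> x" for x y
    by (simp add: circ_eq linear_add[OF \<xi>(1)] linear_diff[OF \<xi>(1)] \<xi>(3,4))
  have \<kappa>_circ: "\<kappa> (circ x y) = 0" for x y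
    unfolding \<kappa>[of "circ x y"] tri_circ by (simp add: linear_diff[OF \<xi>(1)] \<xi>(4))
  define \<eta> where "\<eta> y = \<xi> y - \<kappa> y * (\<xi> e / \<kappa> e)" for y
  have \<eta>_circ: "\<eta> (circ e y) = \<kappa> e * \<eta> y" for y
    using e by (simp add: \<eta>_def \<xi>_circ \<kappa>_circ field_simps)
  have \<eta>_zero: "\<eta> y = 0" for y
  proof -
    have "(circ e ^^ n) y \<in> lower_central_series circ n" for n
    proof (induction n)
      case (Suc n)
      then have "circ e ((circ e ^^ n) y) \<in> {circ x y | x y. y \<in> lower_central_series circ n}" by blast
      then show ?case by (simp add: span_base)
    qed simp
    moreover obtain n where "lower_central_series circ n = {0}" using nil by (auto simp: nilpotent_lie_def)
    ultimately have "(circ e ^^ n) y = 0" by blast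
    moreover have "\<eta> ((circ e ^^ n) y) = \<kappa> e ^ n * \<eta> y"
      by (induction n) (simp_all add: \<eta>_circ)
    moreover have "\<eta> 0 = 0"
      using linear_0[OF \<xi>(1)] linear_0[OF \<open>linear \<kappa>\<close>] by (simp add: \<eta>_def)
    ultimately have "\<kappa> e ^ n * \<eta> y = 0" by simp
    then show ?thesis using e by simp
  qed
  have proportional: "\<xi> y = \<kappa> y * (\<xi> e / \<kappa> e)" for y
    using \<eta>_zero[of y] unfolding \<eta>_def right_minus_eq .
  have "\<xi> e / \<kappa> e \<noteq> 0" using proportional[of u] u by auto
  moreover have "\<kappa> (tri x y) * (\<xi> e / \<kappa> e) = \<kappa> x * \<kappa> y * (\<xi> e / \<kappa> e)"
    using \<xi>(4)[of x y] unfolding proportional[of y] proportional[of "tri x y"] by (simp only: mult.assoc)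
  ultimately show "\<kappa> (tri x y) = \<kappa> x * \<kappa> y" by simp
qed

lemma hyperplane_ideal:
  fixes l :: "'g \<Rightarrow> real"
  assumes l: "linear l" "\<And>x y. l (dot x y) = 0" "\<And>x y. l (tri x y) = 0" and u: "l u \<noteq> 0"
    and dim: "dim (UNIV :: 'g set) > 1"
  shows "\<exists>I. post_lie_ideal dot tri I \<and> I \<noteq> {0} \<and> I \<noteq> UNIV \<and> trivial_quotient dot circ tri I"
proof (intro exI conjI)
  define I where "I = {x. l x = 0}"
  have I: "subspace I"
    by (rule subspaceI) (auto simp: I_def linear_0[OF l(1)] linear_add[OF l(1)] linear_cmul[OF l(1)])
  then show ideal: "post_lie_ideal dot tri I" by (simp add: post_lie_ideal_def I_def l)
  show "I \<noteq> UNIV" using u by (auto simp: I_def)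
  show "I \<noteq> {0}"
  proof
    assume I0: "I = {0}"
    have "x \<in> span {u}" for x
    proof -
      have "x - (l x / l u) *\<^sub>R u \<in> I"
        using u by (simp add: I_def linear_diff[OF l(1)] linear_cmul[OF l(1)])
      then have "x = (l x / l u) *\<^sub>R u" using I0 by simp
      then show ?thesis by (metis span_base span_scale singletonI)
    qed
    then have "dim (UNIV :: 'g set) \<le> card {u}" by (intro real_vector.dim_le_card) auto
    with dim show False by simp
  qed
  have coset: "coset I z = I" if "z \<in> I" for z
  proof -
    have "coset I z = coset I 0" using that by (simp add: coset_eq_iff[OF I])
    then show ?thesis by (simp add: coset_def)
  qed
  have "dot x y \<in> I" "circ x y \<in> I" "tri x y \<in> I" for x y
    by (simp_all add: I_def l circ_eq linear_add[OF l(1)] linear_diff[OF l(1)])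
  then show "trivial_quotient dot circ tri I"
    unfolding trivial_quotient_def trivial_post_lie_def quotient_space_def
    by (auto simp: ideal_quotient_op_coset[OF ideal] coset)
qed

end

theorem proposition3p5:
  fixes dot circ tri :: "'g::real_vector \<Rightarrow> 'g \<Rightarrow> 'g"
  assumes "post_lie_algebra dot circ tri"
    and "integrable_post_lie TYPE('a::{t2_space,second_countable_topology})
           TYPE('e::euclidean_space) dot circ tri"
    and "nilpotent_lie dot"
    and "nilpotent_lie circ"
    and "dim (UNIV :: 'g set) > 1"
  shows "\<exists>I. post_lie_ideal dot tri I \<and> I \<noteq> {0} \<and> I \<noteq> UNIV \<and> trivial_quotient dot circ tri I"
proof -
  interpret post_lie_algebra dot circ tri by fact
  have "(UNIV :: 'g set) \<noteq> {0}"
  proof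
    assume zero: "(UNIV :: 'g set) = {0}"
    have "dim (UNIV :: 'g set) \<le> card {0 :: 'g}"
      by (rule real_vector.dim_le_card) (unfold zero, simp_all)
    with assms(5) show False by simp
  qed
  then obtain \<xi> :: "'g \<Rightarrow> complex" and \<kappa> where \<xi>: "linear \<xi>" "\<xi> \<noteq> 0"
    "\<forall>x y. \<xi> (dot x y) = 0" "\<forall>x y. \<xi> (tri x y) = \<kappa> x * \<xi> y"
    by (rule eigenfunctional_exists[OF assms(3,4)])
  note \<xi>' = \<xi>(1,2) \<xi>(3,4)[rule_format]
  have \<kappa>: "\<kappa> x = 0" for x
  proof (rule ccontr)
    assume nz: "\<kappa> x \<noteq> 0"
    obtain A :: "('a, 'e) chart set" and G H and \<Phi> :: "'g \<Rightarrow> 'a tangent" where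
      brace: "lie_skew_brace A G H" "connected (UNIV :: 'a set)"
      "bij_betw \<Phi> UNIV (tangent_space A \<one>\<^bsub>G\<^esub>)"
      "\<forall>x y f. \<Phi> (x + y) f = \<Phi> x f + \<Phi> y f" "\<forall>c x f. \<Phi> (c *\<^sub>R x) f = c * \<Phi> x f"
      "\<forall>x y. \<Phi> (tri x y) = brace_triangle A G H (\<Phi> x) (\<Phi> y)"
      using assms(2) unfolding integrable_post_lie_def by (elim exE conjE) (rule that)
    have "lie_skew_brace_character A G H \<Phi> tri \<kappa>"
    proof (intro lie_skew_brace_character.intro lie_skew_brace_tangent.intro
        lie_skew_brace_character_axioms.intro)
      show "\<Phi> (x + y) f = \<Phi> x f + \<Phi> y f" for x y f by (rule brace(4)[rule_format])
      show "\<Phi> (r *\<^sub>R x) f = r * \<Phi> x f" for r x f by (rule brace(5)[rule_format])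
      show "\<Phi> (tri x y) = brace_triangle A G H (\<Phi> x) (\<Phi> y)" for x y
        by (rule brace(6)[rule_format])
      show "linear \<kappa>"
        by (rule eigenvalue_multiplicative[OF \<xi>' assms(4) nz])
      show "\<kappa> (tri x y) = \<kappa> x * \<kappa> y" for x y
        by (rule eigenvalue_multiplicative[OF \<xi>' assms(4) nz])
    qed (fact brace)+
    from lie_skew_brace_character.character_trivial[OF this, of x] nz show False by simp
  qed
  have kill: "\<xi> (dot x y) = 0" "\<xi> (tri x y) = 0" for x y by (simp_all add: \<xi>' \<kappa>)
  have lin: "linear (\<lambda>x. Re (\<xi> x))" "linear (\<lambda>x. Im (\<xi> x))"
    using \<xi>(1) by (simp_all add: linear_iff)
  obtain u where "\<xi> u \<noteq> 0" using \<xi>(2) by (auto simp: fun_eq_iff)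
  then consider "Re (\<xi> u) \<noteq> 0" | "Im (\<xi> u) \<noteq> 0" by (auto simp: complex_eq_iff)
  then show ?thesis
  proof cases
    case 1
    show ?thesis
      by (rule hyperplane_ideal[OF lin(1) _ _ 1 assms(5)]) (simp_all add: kill)
  next
    case 2
    show ?thesis
      by (rule hyperplane_ideal[OF lin(2) _ _ 2 assms(5)]) (simp_all add: kill)
  qed
qed

end
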